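(* Let $\delta\in(0,\pi/2)$. For every real $N\ge0$ there exists a (small) $\epsilon>0$, with $\delta+\epsilon\le\pi/2$, such that $$\|\chi_{\delta+\epsilon}(D)f\|_{H^{-1/2}(\mathbb{R}^2)}\le 2\,\|R_\delta f\|_{L^2(\mathbb{R}\times\mathbb{S}^1)}$$ for all $f\in\mathcal{D}_{N,\epsilon}$, where $$\mathcal{D}_{N,\epsilon}=\{f\in L^2(\mathcal{B}):\ \|f\|_{L^2}\le N\,\|\chi_{\delta+\epsilon}(D)f\|_{H^{-1/2}(\mathbb{R}^2)}\},$$ $\mathcal{B}=\{x\in\mathbb{R}^2:|x|<1\}$, $R_\delta$ is the limited angle Radon transform, and $\chi_{\delta+\epsilon}(D)$ is the Fourier multiplier whose symbol is the characteristic function of the cone $\mathcal{K}_{\delta+\epsilon}=\{\xi\in\mathbb{R}^2\setminus\{0\}:\xi/|\xi|\in\mathcal{S}_{\delta+\epsilon}\}$, with $\mathcal{S}_\beta=\{(\cos\theta,\sin\theta):|\theta|\le\beta\}$.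
   Context: Notation. $|\cdot|$ is the Euclidean norm on $\mathbb{R}^2$ and $\mathbb{S}^1$ is the unit circle with arclength measure. For $\beta\in(0,\pi/2]$, $\mathcal{S}_\beta=\{(\cos\theta,\sin\theta)\in\mathbb{S}^1:|\theta|\le\beta\}$, and $\chi_\beta(v)$, $v\in\mathbb{S}^1$, denotes the characteristic function of $\mathcal{S}_\beta$. For $v\in\mathbb{S}^1$, $v^\perp$ is the unit vector orthogonal to $v$ such that $\{v,v^\perp\}$ has the same orientation as the standard coordinate frame. The limited angle Radon transform of a function $f$ on $\mathbb{R}^2$ is $$R_\delta f(p,v)=\int_{\mathbb{R}}\chi_\delta(v)\,f(pv+tv^\perp)\,dt,\qquad p\in\mathbb{R},\ v\in\mathbb{S}^1 .$$ Elements of $L^2(\mathcal{B})$ are extended by zero to $\mathbb{R}^2$. Fourier conventions: $\hat f(\xi)=\int_{\mathbb{R}^2}e^{-ix\cdot\xi}f(x)\,dx$. The Sobolev norm is normalized so that $H^0=L^2$ isometrically: $\|f\|_{H^{s}(\mathbb{R}^2)}^2=(2\pi)^{-2}\int_{\mathbb{R}^2}(1+|\xi|^2)^{s}|\hat f(\xi)|^2\,d\xi$. The same symbol $\chi_\beta$ also denotes the characteristic function on $\mathbb{R}^2$ of the cone $\mathcal{K}_\beta=\{\xi\in\mathbb{R}^2\setminus\{0\}:\xi/|\xi|\in\mathcal{S}_\beta\}$, i.e. $\chi_\beta(\xi)=\chi_\beta(\xi/|\xi|)$ for $\xi\ne0$. The Fourier multiplier $\chi_\beta(D)$ is defined by $\chi_\beta(D)f=(\chi_\beta\hat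 f)^\vee$, where ${}^\vee$ is the inverse Fourier transform. *)

theory Defs
  imports "HOL-Analysis.Analysis"
begin

section \<open>Square-integrable functions\<close>

text \<open>Elements of \<open>L\<^sup>2\<close> are represented by measurable functions, everywhere defined; every norm
  below depends only on the class modulo null sets. Norms take values in \<^typ>\<open>ennreal\<close>, so that
  the norm of a function outside the space is \<open>\<infinity>\<close> and not a default value.\<close>

definition ennreal_sqrt :: "ennreal \<Rightarrow> ennreal" where
  "ennreal_sqrt a = (if a = \<infinity> then \<infinity> else ennreal (sqrt (enn2real a)))"

definition L2_norm :: "'a measure \<Rightarrow> ('a \<Rightarrow> complex) \<Rightarrow> ennreal" where
  "L2_norm M f = ennreal_sqrt (\<integral>\<^sup>+ x. ennreal ((cmod (f x))\<^sup>2) \<partial>M)"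

definition L2 :: "'a measure \<Rightarrow> ('a \<Rightarrow> complex) set" where
  "L2 M = {f \<in> borel_measurable M. L2_norm M f < \<infinity>}"

definition L2_unit_ball :: "(real^2 \<Rightarrow> complex) set" where
  "L2_unit_ball = {f \<in> L2 lborel. \<forall>x. x \<notin> ball 0 1 \<longrightarrow> f x = 0}"


section \<open>Fourier transform and Sobolev norms\<close>

text \<open>On \<open>L\<^sup>2\<close> the Fourier transform is the \<open>L\<^sup>2\<close> limit of the Fourier integrals over growing
  balls (Plancherel); it is determined up to null sets, and \<open>SOME\<close> picks a representative. If
  \<open>f\<close> vanishes outside a ball, \<^term>\<open>fourier_ball r f\<close> is the Fourier integral of \<open>f\<close> for all
  large \<open>r\<close>.\<close>

definition fourier_ball :: "real \<Rightarrow> (real^2 \<Rightarrow> complex) \<Rightarrow> real^2 \<Rightarrow> complex" where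
  "fourier_ball r f \<xi> = (LINT x:ball 0 r|lborel. exp (- \<i> * complex_of_real (x \<bullet> \<xi>)) * f x)"

definition fourier :: "(real^2 \<Rightarrow> complex) \<Rightarrow> real^2 \<Rightarrow> complex" where
  "fourier f = (SOME g. g \<in> L2 lborel \<and>
     ((\<lambda>r. L2_norm lborel (\<lambda>\<xi>. fourier_ball r f \<xi> - g \<xi>)) \<longlongrightarrow> 0) at_top)"

definition inv_fourier_ball :: "real \<Rightarrow> (real^2 \<Rightarrow> complex) \<Rightarrow> real^2 \<Rightarrow> complex" where
  "inv_fourier_ball r F x =
     (LINT \<xi>:ball 0 r|lborel. exp (\<i> * complex_of_real (x \<bullet> \<xi>)) * F \<xi>) / complex_of_real ((2 * pi)\<^sup>2)"

definition inv_fourier :: "(real^2 \<Rightarrow> complex) \<Rightarrow> real^2 \<Rightarrow> complex" where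
  "inv_fourier F = (SOME g. g \<in> L2 lborel \<and>
     ((\<lambda>r. L2_norm lborel (\<lambda>x. inv_fourier_ball r F x - g x)) \<longlongrightarrow> 0) at_top)"

text \<open>For \<open>f\<close> in \<open>L\<^sup>2\<close>, which suffices here because the multipliers below map \<open>L\<^sup>2\<close> into itself.\<close>

definition sobolev_norm :: "real \<Rightarrow> (real^2 \<Rightarrow> complex) \<Rightarrow> ennreal" where
  "sobolev_norm s f = ennreal_sqrt (ennreal (1 / (2 * pi)\<^sup>2) *
     (\<integral>\<^sup>+ \<xi>. ennreal ((1 + (norm \<xi>)\<^sup>2) powr s * (cmod (fourier f \<xi>))\<^sup>2) \<partial>lborel))"


section \<open>Limited angle Radon transform\<close>

definition circle_point :: "real \<Rightarrow> real^2" where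
  "circle_point \<theta> = vector [cos \<theta>, sin \<theta>]"

definition arclength :: "(real^2) measure" where
  "arclength = distr (restrict_space lborel {-pi<..pi}) (restrict_space borel (sphere 0 1)) circle_point"

definition circle_arc :: "real \<Rightarrow> (real^2) set" where
  "circle_arc \<beta> = {circle_point \<theta> | \<theta>. \<bar>\<theta>\<bar> \<le> \<beta>}"

definition angle_cone :: "real \<Rightarrow> (real^2) set" where
  "angle_cone \<beta> = {\<xi>. \<xi> \<noteq> 0 \<and> \<xi> /\<^sub>R norm \<xi> \<in> circle_arc \<beta>}"

definition perp :: "real^2 \<Rightarrow> real^2" where
  "perp v = vector [- v $ 2, v $ 1]"

definition radon :: "real \<Rightarrow> (real^2 \<Rightarrow> complex) \<Rightarrow> real \<times> (real^2) \<Rightarrow> complex" where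
  "radon \<delta> f = (\<lambda>(p, v). LINT t|lborel. indicator (circle_arc \<delta>) v * f (p *\<^sub>R v + t *\<^sub>R perp v))"

definition cone_multiplier :: "real \<Rightarrow> (real^2 \<Rightarrow> complex) \<Rightarrow> real^2 \<Rightarrow> complex" where
  "cone_multiplier \<beta> f = inv_fourier (\<lambda>\<xi>. indicator (angle_cone \<beta>) \<xi> * fourier f \<xi>)"

definition D_set :: "real \<Rightarrow> real \<Rightarrow> real \<Rightarrow> (real^2 \<Rightarrow> complex) set" where
  "D_set \<delta> N \<epsilon> = {f \<in> L2_unit_ball.
     L2_norm lborel f \<le> ennreal N * sobolev_norm (-1/2) (cone_multiplier (\<delta> + \<epsilon>) f)}"

end

theory Submission
  imports Defs "HOL-Probability.Characteristic_Functions"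
begin

text \<open>By the Fourier slice theorem and Plancherel on lines, \<open>2 * pi\<close> times the square of the norm of
  \<open>R\<^sub>\<delta> f\<close> bounds the integral of \<open>|f^(\<xi>)|\<^sup>2 / |\<xi>|\<close> over the cone of opening \<open>\<delta>\<close>, hence the part of
  the \<open>H\<^sup>-\<^sup>1\<^sup>/\<^sup>2\<close> norm coming from that cone. On the remaining thin sector, frequencies \<open>|\<xi>| \<ge> M\<close>
  contribute at most \<open>\<parallel>f\<parallel>\<^sup>2 / M\<close>; for \<open>|\<xi>| < M\<close> the transform is bounded by a multiple of \<open>\<parallel>f\<parallel>\<close>
  because \<open>f\<close> has compact support, and the area tends to 0 with \<open>\<epsilon>\<close>. Since \<open>\<parallel>f\<parallel>\<close> is controlled by
  the left-hand side on \<open>D_set\<close>, both errors are absorbed.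

  The \<open>L\<^sup>2\<close> theory is obtained from Gaussian regularization: it gives the Bessel inequality for
  arbitrary functions, and Parseval's identity when one of the two functions is the indicator of a
  box. The latter, tested against all boxes, yields the inversion theorem, so that no density
  argument is needed.\<close>

section \<open>The Fourier integral and Gaussians\<close>

text \<open>The norm on the left is built from \<open>fourier\<close> of
  \<open>cone_multiplier\<close>, hence from two successive L2 limits picked by \<open>SOME\<close>,
  and the sharp cutoff to a cone leaves nothing better than square integrability. This is what
  forces an inversion theorem on all of L2. Elsewhere Bessel's inequality suffices, because the
  Radon norm only has to be bounded from below. Write a for the squared left-hand side and b for the
  squared Radon norm. The inner cone contributes at most b / (2 * pi), and each of the two errors is
  made at most a / 4, so a \<le> b / pi, well below the 4 * b that the factor 2 allows. The
  threshold M, the admissible area and then \<epsilon> are all fixed before f, and \<delta> +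
  \<epsilon> stays strictly below pi / 2, where the tangent is finite and increasing. In
  \<open>ft\<close> the sign is a parameter: s = -1 is the forward kernel, s = 1 the inverse kernel
  without its normalizing factor. The dimension is arbitrary because both the line and the plane
  occur.\<close>

definition ft :: "real \<Rightarrow> ('a::euclidean_space \<Rightarrow> complex) \<Rightarrow> 'a \<Rightarrow> complex" where
  "ft s f \<xi> = (LINT x|lborel. cis (s * (x \<bullet> \<xi>)) * f x)"

lemma cis_measurable [measurable]: "cis \<in> borel_measurable borel"
  by (intro borel_measurable_continuous_onI continuous_intros)

lemma integrable_cis_mult:
  assumes "integrable lborel f" "g \<in> borel_measurable borel"
  shows "integrable lborel (\<lambda>x. cis (g x) * f x)"
proof (rule Bochner_Integration.integrable_bound[OF assms(1)])
  show "(\<lambda>x. cis (g x) * f x) \<in> borel_measurable lborel"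
    using assms by measurable
qed (auto simp: norm_mult)

lemma norm_ft_le: "norm (ft s f \<xi>) \<le> (LINT x|lborel. norm (f x))"
  unfolding ft_def by (rule order_trans[OF integral_norm_bound]) (simp add: norm_mult)

lemma ft_measurable [measurable]:
  fixes f :: "'a::euclidean_space \<Rightarrow> complex"
  assumes [measurable]: "f \<in> borel_measurable borel"
  shows "ft s f \<in> borel_measurable borel"
proof -
  have "(\<lambda>\<xi>. LINT x|lborel. cis (s * (x \<bullet> \<xi>)) * f x) \<in> borel_measurable borel"
    by measurable
  then show ?thesis by (simp add: ft_def[abs_def])
qed

lemma ft_diff:
  assumes "integrable lborel f" "integrable lborel g"
  shows "ft s (\<lambda>x. f x - g x) \<xi> = ft s f \<xi> - ft s g \<xi>"
  using assms unfolding ft_def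
  by (simp add: right_diff_distrib integrable_cis_mult)

lemma ft_cnj: "ft (- s) (\<lambda>x. cnj (f x)) \<xi> = cnj (ft s f \<xi>)"
proof -
  have "cnj (ft s f \<xi>) = (LINT x|lborel. cnj (cis (s * (x \<bullet> \<xi>)) * f x))"
    unfolding ft_def by (rule Bochner_Integration.integral_cnj[symmetric])
  then show ?thesis by (simp add: ft_def cis_cnj)
qed

text \<open>The kernel is symmetric in its two variables, so Fubini moves the transform from one
  factor to the other. Both the Gaussian regularization and the duality step of the inversion
  theorem rest on this.\<close>

lemma ft_multiplication:
  fixes u w :: "'a::euclidean_space \<Rightarrow> complex"
  assumes u: "integrable lborel u" and w: "integrable lborel w"
  shows "(LINT x|lborel. u x * ft s w x) = (LINT x|lborel. w x * ft s u x)"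
proof -
  have [measurable]: "u \<in> borel_measurable borel" "w \<in> borel_measurable borel"
    using u w by auto
  define H where "H = (\<lambda>(x::'a) y. u x * (cis (s * (y \<bullet> x)) * w y))"
  have int: "integrable (lborel \<Otimes>\<^sub>M lborel) (case_prod H)"
  proof (rule lborel_pair.Fubini_integrable)
    show "case_prod H \<in> borel_measurable (lborel \<Otimes>\<^sub>M lborel)"
      unfolding H_def by measurable
    have "(\<lambda>x. LINT y|lborel. norm (case_prod H (x, y))) = (\<lambda>x. norm (u x) * (LINT y|lborel. norm (w y)))"
      by (simp add: H_def norm_mult)
    then show "integrable lborel (\<lambda>x. LINT y|lborel. norm (case_prod H (x, y)))"
      using u by (simp add: integrable_norm)
    show "AE x in lborel. integrable lborel (\<lambda>y. case_prod H (x, y))"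
      unfolding H_def by (auto intro!: AE_I2 integrable_mult_right integrable_cis_mult w)
  qed
  have "(LINT x|lborel. u x * ft s w x) = (LINT x|lborel. LINT y|lborel. H x y)"
    unfolding ft_def H_def by simp
  also have "\<dots> = (LINT y|lborel. LINT x|lborel. H x y)"
    by (rule lborel_pair.Fubini_integral[OF int, symmetric])
  also have "\<dots> = (LINT y|lborel. w y * ft s u y)"
    unfolding ft_def H_def
    by (subst integral_mult_right_zero[symmetric])
       (auto intro!: Bochner_Integration.integral_cong simp: inner_commute mult_ac)
  finally show ?thesis .
qed

section \<open>The Gaussian and its transform\<close>

definition gauss :: "'a::euclidean_space \<Rightarrow> real" where
  "gauss x = exp (- (norm x)\<^sup>2 / 2)"

lemma gauss_pos [simp]: "0 < gauss x" "0 \<le> gauss x" and gauss_le_1 [simp]: "gauss x \<le> 1"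
  by (auto simp: gauss_def)

lemma gauss_measurable [measurable]: "gauss \<in> borel_measurable borel"
  unfolding gauss_def[abs_def] by measurable

lemma gauss_real: "gauss (x::real) = sqrt (2 * pi) * std_normal_density x"
  by (simp add: gauss_def std_normal_density_def)

text \<open>The value is read off from the characteristic function of the standard normal
  distribution.\<close>

lemma integral_cis_gauss_real:
  fixes t :: real
  shows "integrable lborel (\<lambda>x. cis (t * x) * complex_of_real (gauss x))"
    and "(LINT x|lborel. cis (t * x) * complex_of_real (gauss x)) = sqrt (2 * pi) * gauss t"
proof -
  have "integrable lborel (\<lambda>x. complex_of_real (gauss (x::real)))"
    unfolding gauss_real by (intro integrable_of_real integrable_mult_right integrable_normal_density) simp
  then show "integrable lborel (\<lambda>x. cis (t * x) * complex_of_real (gauss x))"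
    by (intro integrable_cis_mult) auto
  have "complex_of_real (gauss t) = char std_normal_distribution t"
    by (simp add: char_std_normal_distribution gauss_def)
  also have "\<dots> = (LINT x|lborel. std_normal_density x *\<^sub>R cis (t * x))"
    unfolding char_def by (subst integral_density) (auto simp: cis_conv_exp)
  finally have "complex_of_real (sqrt (2 * pi)) * gauss t =
      sqrt (2 * pi) * (LINT x|lborel. std_normal_density x *\<^sub>R cis (t * x))" by simp
  also have "\<dots> = (LINT x|lborel. sqrt (2 * pi) * (std_normal_density x *\<^sub>R cis (t * x)))"
    by (rule integral_mult_right_zero[symmetric])
  also have "\<dots> = (LINT x|lborel. cis (t * x) * complex_of_real (gauss x))"
    unfolding gauss_real
    by (intro Bochner_Integration.integral_cong) (simp_all add: scaleR_conv_of_real)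
  finally show "(LINT x|lborel. cis (t * x) * complex_of_real (gauss x)) = sqrt (2 * pi) * gauss t"
    by simp
qed

lemma gauss_prod: "gauss (x::'a::euclidean_space) = (\<Prod>b\<in>Basis. gauss (x \<bullet> b))"
proof -
  have "(norm x)\<^sup>2 = (\<Sum>b\<in>Basis. (x \<bullet> b)\<^sup>2)"
    by (subst power2_norm_eq_inner, subst euclidean_inner) (simp add: power2_eq_square)
  then show ?thesis
    by (simp add: gauss_def exp_sum[symmetric] sum_negf sum_divide_distrib)
qed

text \<open>Lebesgue measure is the image of a product of lines, and both the character and the
  Gaussian factor over the coordinates. With variance one the Gaussian is its own transform up to
  the constant, so no second family of functions is needed.\<close>

lemma
  fixes \<xi> :: "'a::euclidean_space"
  shows integrable_gauss: "integrable lborel (\<lambda>x::'a. complex_of_real (gauss x))"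
    and ft_gauss: "ft s (\<lambda>x. complex_of_real (gauss x)) \<xi> = sqrt (2 * pi) ^ DIM('a) * gauss (s *\<^sub>R \<xi>)"
proof -
  interpret product_sigma_finite "\<lambda>_::'a. lborel :: real measure" ..
  have prod: "cis (s * ((\<Sum>b\<in>Basis. x b *\<^sub>R b) \<bullet> \<xi>)) * complex_of_real (gauss (\<Sum>b\<in>Basis. x b *\<^sub>R b)) =
      (\<Prod>b\<in>Basis. cis ((s * (\<xi> \<bullet> b)) * x b) * complex_of_real (gauss (x b)))" for x s and \<xi> :: 'a
  proof -
    have "(\<Prod>b\<in>A. cis (g b)) = cis (\<Sum>b\<in>A. g b)" if "finite A" for g and A :: "'a set"
      using that by induction (auto simp: cis_mult)
    moreover have "(\<Sum>b\<in>Basis. x b *\<^sub>R b) \<bullet> \<xi> = (\<Sum>b\<in>Basis. x b * (\<xi> \<bullet> b))"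
      by (simp add: inner_sum_left) (simp add: inner_commute)
    ultimately show ?thesis
      by (subst gauss_prod) (simp add: prod.distrib sum_distrib_left mult_ac inner_sum_left_Basis)
  qed
  have integrable: "integrable lborel (\<lambda>x::'a. cis (s * (x \<bullet> \<xi>)) * complex_of_real (gauss x))" for s \<xi>
  proof (subst lborel_eq, subst integrable_distr_eq)
    show "integrable (Pi\<^sub>M Basis (\<lambda>b. lborel))
     (\<lambda>x. cis (s * ((\<Sum>b\<in>Basis. x b *\<^sub>R b) \<bullet> \<xi>)) * complex_of_real (gauss (\<Sum>b\<in>Basis. x b *\<^sub>R b)))"
      unfolding prod by (intro product_integrable_prod integral_cis_gauss_real) auto
  qed auto
  from integrable[of 0] show "integrable lborel (\<lambda>x::'a. complex_of_real (gauss x))" by simp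
  have "ft s (\<lambda>x. complex_of_real (gauss x)) \<xi> =
     integral\<^sup>L (Pi\<^sub>M Basis (\<lambda>b. lborel)) (\<lambda>x. \<Prod>b\<in>Basis. cis ((s * (\<xi> \<bullet> b)) * x b) * complex_of_real (gauss (x b)))"
    unfolding ft_def prod[symmetric] by (subst lborel_eq, subst integral_distr) auto
  also have "\<dots> = (\<Prod>b\<in>Basis. complex_of_real (sqrt (2 * pi)) * gauss (s * (\<xi> \<bullet> b)))"
    by (subst product_integral_prod) (auto intro!: integral_cis_gauss_real simp: integral_cis_gauss_real)
  also have "\<dots> = sqrt (2 * pi) ^ DIM('a) * gauss (s *\<^sub>R \<xi>)"
    by (subst gauss_prod) (simp add: prod.distrib)
  finally show "ft s (\<lambda>x. complex_of_real (gauss x)) \<xi> = sqrt (2 * pi) ^ DIM('a) * gauss (s *\<^sub>R \<xi>)" .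
qed

lemma integrable_gauss_real: "integrable lborel (gauss :: 'a::euclidean_space \<Rightarrow> real)"
  using integrable_gauss by (simp add: complex_of_real_integrable_eq)

lemma integral_gauss: "(LINT x|lborel. gauss (x::'a::euclidean_space)) = sqrt (2 * pi) ^ DIM('a)"
proof -
  have "complex_of_real (LINT x|lborel. gauss (x::'a)) = ft 0 (\<lambda>x. complex_of_real (gauss (x::'a))) 0"
    by (simp add: ft_def)
  also have "\<dots> = sqrt (2 * pi) ^ DIM('a)"
    by (subst ft_gauss) (simp add: gauss_def)
  finally show ?thesis by (simp only: of_real_eq_iff flip: of_real_power)
qed

section \<open>Affine substitutions and the Gaussian-weighted pairing\<close>

lemma has_bochner_integral_affine:
  fixes f :: "'a::euclidean_space \<Rightarrow> 'b::{banach, second_countable_topology}"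
  assumes "integrable lborel f" "c \<noteq> 0"
  shows "has_bochner_integral lborel (\<lambda>x. \<bar>c\<bar> ^ DIM('a) *\<^sub>R f (t + c *\<^sub>R x)) (integral\<^sup>L lborel f)"
proof -
  have [measurable]: "f \<in> borel_measurable borel" using assms by auto
  have "integrable (density (distr lborel borel (\<lambda>x. t + c *\<^sub>R x)) (\<lambda>_. ennreal (\<bar>c\<bar> ^ DIM('a)))) f"
    using assms by (simp flip: lborel_affine)
  then have int: "integrable lborel (\<lambda>x. \<bar>c\<bar> ^ DIM('a) *\<^sub>R f (t + c *\<^sub>R x))"
    by (subst (asm) integrable_density) (auto simp: integrable_distr_eq)
  have "integral\<^sup>L lborel f = integral\<^sup>L (density (distr lborel borel (\<lambda>x. t + c *\<^sub>R x)) (\<lambda>_. ennreal (\<bar>c\<bar> ^ DIM('a)))) f"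
    using assms by (simp flip: lborel_affine)
  also have "\<dots> = (LINT x|lborel. \<bar>c\<bar> ^ DIM('a) *\<^sub>R f (t + c *\<^sub>R x))"
    by (subst integral_density) (auto simp: integral_distr)
  finally show ?thesis using int by (simp add: has_bochner_integral_iff)
qed

lemma integrable_affine:
  fixes f :: "'a::euclidean_space \<Rightarrow> 'b::{banach, second_countable_topology}"
  assumes "integrable lborel f" "c \<noteq> 0"
  shows "integrable lborel (\<lambda>x. f (t + c *\<^sub>R x))"
proof -
  have "integrable lborel (\<lambda>x. \<bar>c\<bar> ^ DIM('a) *\<^sub>R f (t + c *\<^sub>R x))"
    using has_bochner_integral_affine[OF assms, of t] unfolding has_bochner_integral_iff by blast
  from integrable_scaleR_right[OF this, of "1 / \<bar>c\<bar> ^ DIM('a)"] show ?thesis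
    using assms by simp
qed

text \<open>The Gaussian weight makes the product of the two transforms integrable, so
  \<open>ft_multiplication\<close> applies and turns the weight into a convolution of
  \<open>\<phi>\<close> with a Gaussian of width e. The convolution is written as an average of
  shifted copies of \<open>\<phi>\<close> against a fixed Gaussian: then e \<rightarrow> 0 is a
  limit under an integral with a fixed weight.\<close>

lemma integral_ft_mult_gauss:
  fixes F \<phi> :: "'a::euclidean_space \<Rightarrow> complex"
  assumes F: "integrable lborel F" and \<phi>: "integrable lborel \<phi>" and e: "e > 0"
  shows "integrable lborel (\<lambda>\<xi>. gauss (e *\<^sub>R \<xi>) * ft (-1) \<phi> \<xi> * ft 1 F \<xi>)"
    and "(LINT \<xi>|lborel. gauss (e *\<^sub>R \<xi>) * ft (-1) \<phi> \<xi> * ft 1 F \<xi>) =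
     sqrt (2 * pi) ^ DIM('a) * (LINT y|lborel. F y * (LINT z|lborel. \<phi> (y - e *\<^sub>R z) * gauss z))"
proof -
  have [measurable]: "F \<in> borel_measurable borel" "\<phi> \<in> borel_measurable borel"
    using F \<phi> by auto
  define C where "C = sqrt (2 * pi) ^ DIM('a)"
  have g: "integrable lborel (\<lambda>\<xi>::'a. complex_of_real (gauss (e *\<^sub>R \<xi>)))"
    using integrable_affine[OF integrable_gauss, of e 0] e by simp
  have u: "integrable lborel (\<lambda>\<xi>. gauss (e *\<^sub>R \<xi>) * ft (-1) \<phi> \<xi>)"
  proof (rule Bochner_Integration.integrable_bound)
    show "integrable lborel (\<lambda>\<xi>::'a. complex_of_real (gauss (e *\<^sub>R \<xi>)) * of_real (LINT x|lborel. norm (\<phi> x)))"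
      using g by simp
  qed (auto simp: norm_mult intro!: mult_left_mono norm_ft_le AE_I2 order_trans[OF norm_ft_le])
  show "integrable lborel (\<lambda>\<xi>. gauss (e *\<^sub>R \<xi>) * ft (-1) \<phi> \<xi> * ft 1 F \<xi>)"
  proof (rule Bochner_Integration.integrable_bound)
    show "integrable lborel (\<lambda>\<xi>::'a. gauss (e *\<^sub>R \<xi>) * ft (-1) \<phi> \<xi> * of_real (LINT x|lborel. norm (F x)))"
      using u by simp
  qed (auto simp: norm_mult intro!: mult_left_mono norm_ft_le AE_I2 order_trans[OF norm_ft_le])
  \<comment> \<open>The same duality once more, now with the modulated Gaussian as one factor; its
    transform is a Gaussian of width e centred at y.\<close>
  have inner: "ft 1 (\<lambda>\<xi>. gauss (e *\<^sub>R \<xi>) * ft (-1) \<phi> \<xi>) y = C * (LINT z|lborel. \<phi> (y - e *\<^sub>R z) * gauss z)" for y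
  proof -
    have iy: "integrable lborel (\<lambda>\<xi>::'a. cis (y \<bullet> \<xi>) * complex_of_real (gauss (e *\<^sub>R \<xi>)))"
      using g by (rule integrable_cis_mult) auto
    have k: "ft (-1) (\<lambda>\<xi>. cis (y \<bullet> \<xi>) * complex_of_real (gauss (e *\<^sub>R \<xi>))) x =
       C / e ^ DIM('a) * gauss ((y - x) /\<^sub>R e)" for x
    proof -
      have "ft (-1) (\<lambda>\<xi>. cis (y \<bullet> \<xi>) * complex_of_real (gauss (e *\<^sub>R \<xi>))) x =
        (LINT \<xi>|lborel. cis ((y - x) \<bullet> \<xi>) * complex_of_real (gauss (e *\<^sub>R \<xi>)))"
        unfolding ft_def mult.assoc[symmetric] cis_mult
        by (simp add: inner_diff_left inner_commute algebra_simps)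
      also have "\<dots> = (1 / e ^ DIM('a)) *\<^sub>R (LINT \<xi>|lborel. \<bar>e\<bar> ^ DIM('a) *\<^sub>R (cis (((y - x) /\<^sub>R e) \<bullet> (0 + e *\<^sub>R \<xi>)) * complex_of_real (gauss (0 + e *\<^sub>R \<xi>))))"
        using e by (simp flip: mult.assoc)
      also have "\<dots> = (1 / e ^ DIM('a)) *\<^sub>R (LINT \<xi>|lborel. cis (((y - x) /\<^sub>R e) \<bullet> \<xi>) * complex_of_real (gauss \<xi>))"
        using e by (subst has_bochner_integral_integral_eq[OF has_bochner_integral_affine])
          (auto intro!: integrable_cis_mult integrable_gauss)
      also have "(LINT \<xi>|lborel. cis (((y - x) /\<^sub>R e) \<bullet> \<xi>) * complex_of_real (gauss \<xi>)) =
          ft 1 (\<lambda>x. complex_of_real (gauss x)) ((y - x) /\<^sub>R e)"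
        by (simp add: ft_def inner_commute)
      finally show ?thesis by (simp add: ft_gauss C_def scaleR_conv_of_real)
    qed
    have "ft 1 (\<lambda>\<xi>. gauss (e *\<^sub>R \<xi>) * ft (-1) \<phi> \<xi>) y =
        (LINT \<xi>|lborel. (cis (y \<bullet> \<xi>) * complex_of_real (gauss (e *\<^sub>R \<xi>))) * ft (-1) \<phi> \<xi>)"
      unfolding ft_def by (simp add: inner_commute mult_ac)
    also have "\<dots> = (LINT x|lborel. \<phi> x * (C / e ^ DIM('a) * gauss ((y - x) /\<^sub>R e)))"
      by (subst ft_multiplication[OF iy \<phi>]) (simp add: k)
    \<comment> \<open>The negative scale encodes the substitution x = y - e * z, whose Jacobian
      cancels the power of e in the kernel.\<close>
    also have "\<dots> = (LINT z|lborel. \<bar>-e\<bar> ^ DIM('a) *\<^sub>R (\<phi> (y + (-e) *\<^sub>R z) * (C / e ^ DIM('a) * gauss ((y - (y + (-e) *\<^sub>R z)) /\<^sub>R e))))"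
    proof (subst has_bochner_integral_integral_eq[OF has_bochner_integral_affine])
      have "integrable lborel (\<lambda>x. of_real (C / e ^ DIM('a)) * \<phi> x)" using \<phi> by simp
      then show "integrable lborel (\<lambda>x. \<phi> x * (C / e ^ DIM('a) * gauss ((y - x) /\<^sub>R e)))"
        by (rule Bochner_Integration.integrable_bound)
           (use e in \<open>auto simp: norm_mult norm_divide mult_ac intro!: AE_I2 mult_left_le divide_right_mono mult_left_mono\<close>)
    qed (use e in auto)
    also have "\<dots> = (LINT z|lborel. C * (\<phi> (y - e *\<^sub>R z) * gauss z))"
      using e by (intro Bochner_Integration.integral_cong) (auto simp: scaleR_conv_of_real divide_simps)
    finally show ?thesis by simp
  qed
  have "(LINT \<xi>|lborel. gauss (e *\<^sub>R \<xi>) * ft (-1) \<phi> \<xi> * ft 1 F \<xi>) =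
     (LINT y|lborel. F y * (C * (LINT z|lborel. \<phi> (y - e *\<^sub>R z) * gauss z)))"
    by (subst ft_multiplication[OF u F]) (simp add: inner)
  also have "\<dots> = C * (LINT y|lborel. F y * (LINT z|lborel. \<phi> (y - e *\<^sub>R z) * gauss z))"
    by (subst integral_mult_right_zero[symmetric]) (simp add: mult_ac)
  finally show "(LINT \<xi>|lborel. gauss (e *\<^sub>R \<xi>) * ft (-1) \<phi> \<xi> * ft 1 F \<xi>) =
     sqrt (2 * pi) ^ DIM('a) * (LINT y|lborel. F y * (LINT z|lborel. \<phi> (y - e *\<^sub>R z) * gauss z))"
    by (simp add: C_def)
qed

section \<open>Square-integrable functions\<close>

abbreviation sq_int :: "'a measure \<Rightarrow> ('a \<Rightarrow> complex) \<Rightarrow> ennreal" where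
  "sq_int M f \<equiv> (\<integral>\<^sup>+ x. ennreal ((cmod (f x))\<^sup>2) \<partial>M)"

lemma L2_iff: "f \<in> L2 M \<longleftrightarrow> f \<in> borel_measurable M \<and> sq_int M f < \<infinity>"
  by (auto simp: L2_def L2_norm_def ennreal_sqrt_def less_top)

lemma cmod_add_sq_le: "(cmod (a + b))\<^sup>2 \<le> 2 * (cmod a)\<^sup>2 + 2 * (cmod b)\<^sup>2"
proof -
  have "(cmod (a + b))\<^sup>2 \<le> (cmod a + cmod b)\<^sup>2"
    by (intro power_mono norm_triangle_ineq) auto
  also have "\<dots> \<le> 2 * (cmod a)\<^sup>2 + 2 * (cmod b)\<^sup>2"
    using zero_le_power2[of "cmod a - cmod b"] unfolding power2_sum power2_diff by linarith
  finally show ?thesis .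
qed

lemma sq_int_add_le:
  assumes [measurable]: "f \<in> borel_measurable M" "g \<in> borel_measurable M"
  shows "sq_int M (\<lambda>x. f x + g x) \<le> 2 * sq_int M f + 2 * sq_int M g"
proof -
  have "sq_int M (\<lambda>x. f x + g x) \<le> (\<integral>\<^sup>+ x. 2 * ennreal ((cmod (f x))\<^sup>2) + 2 * ennreal ((cmod (g x))\<^sup>2) \<partial>M)"
  proof (rule nn_integral_mono)
    fix x
    have "ennreal ((cmod (f x + g x))\<^sup>2) \<le> ennreal (2 * (cmod (f x))\<^sup>2 + 2 * (cmod (g x))\<^sup>2)"
      by (intro ennreal_leI cmod_add_sq_le)
    then show "ennreal ((cmod (f x + g x))\<^sup>2) \<le> 2 * ennreal ((cmod (f x))\<^sup>2) + 2 * ennreal ((cmod (g x))\<^sup>2)"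
      by (simp add: ennreal_mult)
  qed
  also have "\<dots> = 2 * sq_int M f + 2 * sq_int M g"
    by (simp add: nn_integral_add nn_integral_cmult)
  finally show ?thesis .
qed

lemma L2_add: "f \<in> L2 M \<Longrightarrow> g \<in> L2 M \<Longrightarrow> (\<lambda>x. f x + g x) \<in> L2 M"
  unfolding L2_iff using sq_int_add_le[of f M g]
  by (auto intro: le_less_trans simp: ennreal_mult_less_top)

lemma L2_diff:
  assumes "f \<in> L2 M" "g \<in> L2 M" shows "(\<lambda>x. f x - g x) \<in> L2 M"
  using L2_add[of f M "\<lambda>x. - g x"] assms by (simp add: L2_iff)

lemma integrable_L2_sq: "f \<in> L2 M \<Longrightarrow> integrable M (\<lambda>x. (cmod (f x))\<^sup>2)"
  by (intro integrableI_nonneg) (auto simp: L2_iff)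

lemma integrable_L2_mult:
  assumes f: "f \<in> L2 M" and g: "g \<in> L2 M"
  shows "integrable M (\<lambda>x. f x * g x)"
proof (rule Bochner_Integration.integrable_bound)
  show "integrable M (\<lambda>x. (cmod (f x))\<^sup>2 + (cmod (g x))\<^sup>2)"
    by (intro Bochner_Integration.integrable_add integrable_L2_sq assms)
  show "(\<lambda>x. f x * g x) \<in> borel_measurable M"
    using assms by (auto simp: L2_iff)
  have "a * b \<le> a\<^sup>2 + b\<^sup>2" if "a \<ge> 0" "b \<ge> 0" for a b :: real
    using zero_le_power2[of "a - b"] mult_nonneg_nonneg[OF that] unfolding power2_diff by linarith
  then show "AE x in M. norm (f x * g x) \<le> norm ((cmod (f x))\<^sup>2 + (cmod (g x))\<^sup>2)"
    by (auto simp: norm_mult)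
qed

text \<open>The weighted inequality 2 * a * b \<le> a^2 / t + t * b^2 stands in for Cauchy-Schwarz:
  it needs no roots of integrals, and the free weight t can be fixed according to g before f is made
  small.\<close>

lemma norm_integral_mult_le:
  assumes f: "f \<in> L2 M" and g: "g \<in> L2 M" and t: "t > 0"
  shows "norm (LINT x|M. f x * g x) \<le> (LINT x|M. (cmod (f x))\<^sup>2) / t + t * (LINT x|M. (cmod (g x))\<^sup>2)"
proof -
  have "norm (LINT x|M. f x * g x) \<le> (LINT x|M. norm (f x * g x))"
    by (rule integral_norm_bound)
  also have "\<dots> \<le> (LINT x|M. (cmod (f x))\<^sup>2 / t + t * (cmod (g x))\<^sup>2)"
  proof (rule integral_mono)
    fix x
    have "0 \<le> (cmod (f x) - t * cmod (g x))\<^sup>2 / t" using t by simp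
    also have "\<dots> = (cmod (f x))\<^sup>2 / t + t * (cmod (g x))\<^sup>2 - 2 * (cmod (f x) * cmod (g x))"
      using t by (simp add: power2_diff field_simps power2_eq_square)
    finally have "2 * (cmod (f x) * cmod (g x)) \<le> (cmod (f x))\<^sup>2 / t + t * (cmod (g x))\<^sup>2" by simp
    moreover have "0 \<le> cmod (f x) * cmod (g x)" by simp
    ultimately show "norm (f x * g x) \<le> (cmod (f x))\<^sup>2 / t + t * (cmod (g x))\<^sup>2"
      unfolding norm_mult by linarith
  qed (use integrable_L2_sq[OF f] integrable_L2_sq[OF g] integrable_L2_mult[OF f g] in \<open>auto intro!: integrable_norm\<close>)
  also have "\<dots> = (LINT x|M. (cmod (f x))\<^sup>2) / t + t * (LINT x|M. (cmod (g x))\<^sup>2)"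
    using integrable_L2_sq[OF f] integrable_L2_sq[OF g] by simp
  finally show ?thesis .
qed

text \<open>Norm convergence implies weak convergence; every exchange of a limit with a pairing
  below goes through this.\<close>

lemma tendsto_integral_L2_mult:
  assumes u: "\<And>r. u r \<in> L2 M" and v: "v \<in> L2 M" and k: "k \<in> L2 M"
    and lim: "((\<lambda>r. sq_int M (\<lambda>x. u r x - v x)) \<longlongrightarrow> 0) F"
  shows "((\<lambda>r. LINT x|M. u r x * k x) \<longlongrightarrow> (LINT x|M. v x * k x)) F"
proof (rule tendstoI)
  fix e :: real assume e: "e > 0"
  define K where "K = (LINT x|M. (cmod (k x))\<^sup>2)"
  have K: "K \<ge> 0" unfolding K_def by simp
  \<comment> \<open>This weight makes the term in \<open>k\<close> less than e / 2; the other term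
    is then below e / 2 once the squared distance is below t * e / 2. The added 1 covers
    \<open>K\<close> = 0.\<close>
  define t where "t = e / (2 * (K + 1))"
  have t: "t > 0" using e K by (simp add: t_def)
  have "t * K < e / 2 + 0"
    using e K by (simp add: t_def field_simps)
  have "eventually (\<lambda>r. sq_int M (\<lambda>x. u r x - v x) < ennreal (t * e / 2)) F"
    using e t by (intro order_tendstoD[OF lim]) simp
  then show "eventually (\<lambda>r. dist (LINT x|M. u r x * k x) (LINT x|M. v x * k x) < e) F"
  proof eventually_elim
    fix r assume r: "sq_int M (\<lambda>x. u r x - v x) < ennreal (t * e / 2)"
    have d: "(\<lambda>x. u r x - v x) \<in> L2 M" by (intro L2_diff u v)
    have "ennreal (LINT x|M. (cmod (u r x - v x))\<^sup>2) < ennreal (t * e / 2)"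
      using r nn_integral_eq_integral[OF integrable_L2_sq[OF d]] by simp
    then have *: "(LINT x|M. (cmod (u r x - v x))\<^sup>2) < t * e / 2"
      by (subst (asm) ennreal_less_iff) auto
    have "dist (LINT x|M. u r x * k x) (LINT x|M. v x * k x) = norm (LINT x|M. (u r x - v x) * k x)"
      using integrable_L2_mult[OF u[of r] k] integrable_L2_mult[OF v k] by (simp add: dist_norm left_diff_distrib)
    also have "\<dots> \<le> (LINT x|M. (cmod (u r x - v x))\<^sup>2) / t + t * K"
      unfolding K_def by (rule norm_integral_mult_le[OF d k t])
    also have "\<dots> < e / 2 + e / 2"
      using * t \<open>t * K < e / 2 + 0\<close> by (intro add_strict_mono) (auto simp: divide_simps mult_ac)
    finally show "dist (LINT x|M. u r x * k x) (LINT x|M. v x * k x) < e" by simp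
  qed
qed

section \<open>Bessel's inequality and Parseval's identity\<close>

lemma nn_integral_translate:
  fixes f :: "'a::euclidean_space \<Rightarrow> ennreal"
  assumes [measurable]: "f \<in> borel_measurable borel"
  shows "(\<integral>\<^sup>+ y. f (y - c) \<partial>lborel) = (\<integral>\<^sup>+ y. f y \<partial>lborel)"
proof -
  have "(\<integral>\<^sup>+ y. f y \<partial>lborel) = (\<integral>\<^sup>+ y. f y \<partial>distr lborel borel ((+) (- c)))"
    by (simp add: lborel_distr_plus)
  also have "\<dots> = (\<integral>\<^sup>+ y. f (y - c) \<partial>lborel)"
    by (subst nn_integral_distr) simp_all
  finally show ?thesis by simp
qed

lemma nn_integral_gauss: "(\<integral>\<^sup>+ x. ennreal (gauss (x::'a::euclidean_space)) \<partial>lborel) = ennreal (sqrt (2 * pi) ^ DIM('a))"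
  using nn_integral_eq_integral[OF integrable_gauss_real] by (simp add: integral_gauss)

text \<open>Pointwise a * b \<le> (a^2 + b^2) / 2 and translation invariance. The bound does not
  depend on the shift, so it survives averaging over shifts without loss.\<close>

lemma nn_integral_autocorrelation_le:
  fixes F :: "'a::euclidean_space \<Rightarrow> complex"
  assumes [measurable]: "F \<in> borel_measurable borel"
  shows "(\<integral>\<^sup>+ y. ennreal (cmod (F y) * cmod (F (y - c))) \<partial>lborel) \<le> sq_int lborel F"
proof -
  have "(\<integral>\<^sup>+ y. ennreal (cmod (F y) * cmod (F (y - c))) \<partial>lborel)
     \<le> (\<integral>\<^sup>+ y. ennreal (1/2) * (ennreal ((cmod (F y))\<^sup>2) + ennreal ((cmod (F (y - c)))\<^sup>2)) \<partial>lborel)"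
  proof (rule nn_integral_mono)
    fix y
    have "2 * (cmod (F y) * cmod (F (y - c))) \<le> (cmod (F y))\<^sup>2 + (cmod (F (y - c)))\<^sup>2"
      using zero_le_power2[of "cmod (F y) - cmod (F (y - c))"] unfolding power2_diff by linarith
    then have "cmod (F y) * cmod (F (y - c)) \<le> 1/2 * ((cmod (F y))\<^sup>2 + (cmod (F (y - c)))\<^sup>2)"
      by simp
    then show "ennreal (cmod (F y) * cmod (F (y - c))) \<le>
        ennreal (1/2) * (ennreal ((cmod (F y))\<^sup>2) + ennreal ((cmod (F (y - c)))\<^sup>2))"
      by (metis ennreal_leI ennreal_mult' ennreal_plus zero_le_power2 zero_le_divide_1_iff zero_le_numeral)
  qed
  also have "\<dots> = ennreal (1/2) * (sq_int lborel F + (\<integral>\<^sup>+ y. ennreal ((cmod (F (y - c)))\<^sup>2) \<partial>lborel))"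
    by (subst nn_integral_cmult) (auto simp: nn_integral_add)
  also have "\<dots> = ennreal (1/2) * (sq_int lborel F + sq_int lborel F)"
    by (subst nn_integral_translate[of "\<lambda>y. ennreal ((cmod (F y))\<^sup>2)"]) auto
  also have "\<dots> = ennreal (1/2) * 2 * sq_int lborel F"
    unfolding mult_2[symmetric] by (simp add: mult.assoc)
  also have "ennreal (1/2) * 2 = 1"
    by (subst ennreal_numeral[symmetric], subst ennreal_mult'[symmetric]) simp_all
  finally show ?thesis by simp
qed

lemma sqrt_two_pi_power: "sqrt (2 * pi) ^ n * sqrt (2 * pi) ^ n = (2 * pi) ^ n"
  by (subst power_mult_distrib[symmetric]) simp

text \<open>Taking the conjugate of \<open>F\<close> as second function turns the Gaussian-weighted
  pairing into a weighted integral of the squared modulus, and the other side into a Gaussian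
  average of autocorrelations. The two factors \<open>sqrt (2 * pi) ^ DIM('a)\<close>, one from the
  identity and one from the mass of the Gaussian, multiply to the Bessel constant.\<close>

lemma sq_int_ft_gauss_le:
  fixes F :: "'a::euclidean_space \<Rightarrow> complex"
  assumes F: "integrable lborel F" and e: "e > 0"
  shows "(\<integral>\<^sup>+ \<xi>. ennreal (gauss (e *\<^sub>R \<xi>) * (cmod (ft 1 F \<xi>))\<^sup>2) \<partial>lborel) \<le> ennreal ((2 * pi) ^ DIM('a)) * sq_int lborel F"
proof -
  have [measurable]: "F \<in> borel_measurable borel" using F by auto
  define C where "C = sqrt (2 * pi) ^ DIM('a)"
  have C: "C \<ge> 0" "C * C = (2 * pi) ^ DIM('a)"
    by (auto simp: C_def sqrt_two_pi_power)
  have cF: "integrable lborel (\<lambda>x. cnj (F x))" using F by simp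
  have eq: "of_real (gauss (e *\<^sub>R \<xi>)) * ft (-1) (\<lambda>x. cnj (F x)) \<xi> * ft 1 F \<xi> =
      complex_of_real (gauss (e *\<^sub>R \<xi>) * (cmod (ft 1 F \<xi>))\<^sup>2)" for \<xi>
  proof -
    have "cnj (ft 1 F \<xi>) * ft 1 F \<xi> = complex_of_real ((cmod (ft 1 F \<xi>))\<^sup>2)"
      by (subst complex_norm_square) (rule mult.commute)
    then show ?thesis by (simp add: ft_cnj mult.assoc)
  qed
  note * = integral_ft_mult_gauss[OF F cF e, unfolded eq]
  have int: "integrable lborel (\<lambda>\<xi>. gauss (e *\<^sub>R \<xi>) * (cmod (ft 1 F \<xi>))\<^sup>2)"
    using *(1) by (simp only: complex_of_real_integrable_eq)
  have "(\<integral>\<^sup>+ \<xi>. ennreal (gauss (e *\<^sub>R \<xi>) * (cmod (ft 1 F \<xi>))\<^sup>2) \<partial>lborel)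
      = ennreal (LINT \<xi>|lborel. gauss (e *\<^sub>R \<xi>) * (cmod (ft 1 F \<xi>))\<^sup>2)"
    by (rule nn_integral_eq_integral[OF int]) simp
  also have "(LINT \<xi>|lborel. gauss (e *\<^sub>R \<xi>) * (cmod (ft 1 F \<xi>))\<^sup>2) =
      cmod (complex_of_real (LINT \<xi>|lborel. gauss (e *\<^sub>R \<xi>) * (cmod (ft 1 F \<xi>))\<^sup>2))"
    by (subst norm_of_real) simp
  also have "\<dots> = C * cmod (LINT y|lborel. F y * (LINT z|lborel. cnj (F (y - e *\<^sub>R z)) * gauss z))"
    using C(1) unfolding *(2)[unfolded integral_complex_of_real] by (simp add: norm_mult C_def norm_power)
  also have "ennreal \<dots> \<le> C * (\<integral>\<^sup>+ y. ennreal (cmod (F y * (LINT z|lborel. cnj (F (y - e *\<^sub>R z)) * gauss z))) \<partial>lborel)"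
  proof -
    \<comment> \<open>A function that is not integrable has integral 0 by convention, so the bound
      holds for every \<open>h\<close>. The same convention is used for the inner integral
      below.\<close>
    have "ennreal (cmod (integral\<^sup>L lborel h)) \<le> (\<integral>\<^sup>+ y. ennreal (cmod (h y)) \<partial>lborel)" for h :: "'a \<Rightarrow> complex"
      by (cases "integrable lborel h") (auto simp: integral_norm_bound_ennreal not_integrable_integral_eq)
    then show ?thesis using C by (auto simp: ennreal_mult intro!: mult_left_mono)
  qed
  also have "\<dots> \<le> C * (\<integral>\<^sup>+ y. \<integral>\<^sup>+ z. ennreal (cmod (F y)) * (ennreal (cmod (F (y - e *\<^sub>R z))) * ennreal (gauss z)) \<partial>lborel \<partial>lborel)"
  proof (intro mult_left_mono nn_integral_mono)
    fix y
    have "ennreal (cmod (LINT z|lborel. cnj (F (y - e *\<^sub>R z)) * gauss z)) \<le>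
        (\<integral>\<^sup>+ z. ennreal (cmod (cnj (F (y - e *\<^sub>R z)) * gauss z)) \<partial>lborel)"
      by (cases "integrable lborel (\<lambda>z. cnj (F (y - e *\<^sub>R z)) * gauss z)")
         (auto simp: integral_norm_bound_ennreal not_integrable_integral_eq)
    then show "ennreal (cmod (F y * (LINT z|lborel. cnj (F (y - e *\<^sub>R z)) * gauss z))) \<le>
       (\<integral>\<^sup>+ z. ennreal (cmod (F y)) * (ennreal (cmod (F (y - e *\<^sub>R z))) * ennreal (gauss z)) \<partial>lborel)"
      by (subst nn_integral_cmult) (auto simp: norm_mult ennreal_mult intro!: mult_left_mono)
  qed simp
  also have "(\<integral>\<^sup>+ y. \<integral>\<^sup>+ z. ennreal (cmod (F y)) * (ennreal (cmod (F (y - e *\<^sub>R z))) * ennreal (gauss z)) \<partial>lborel \<partial>lborel)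
     = (\<integral>\<^sup>+ z. \<integral>\<^sup>+ y. ennreal (gauss z) * ennreal (cmod (F y) * cmod (F (y - e *\<^sub>R z))) \<partial>lborel \<partial>lborel)"
    by (subst lborel_pair.Fubini') (auto intro!: nn_integral_cong simp: ennreal_mult mult_ac)
  also have "\<dots> \<le> (\<integral>\<^sup>+ z. ennreal (gauss (z::'a)) * sq_int lborel F \<partial>lborel)"
    by (intro nn_integral_mono) (auto simp: nn_integral_cmult intro!: mult_left_mono nn_integral_autocorrelation_le)
  also have "\<dots> = ennreal C * sq_int lborel F"
    by (simp add: nn_integral_multc nn_integral_gauss C_def)
  also have "ennreal C * (ennreal C * sq_int lborel F) = ennreal ((2 * pi) ^ DIM('a)) * sq_int lborel F"
    using C by (simp add: mult.assoc[symmetric] flip: ennreal_mult')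
  finally show ?thesis by (simp add: mult_left_mono)
qed

lemma tendsto_gauss_scaled: "(\<lambda>k. gauss (inverse (real (Suc k)) *\<^sub>R \<xi>)) \<longlonglongrightarrow> 1"
proof -
  have "(\<lambda>k. gauss (inverse (real (Suc k)) *\<^sub>R \<xi>)) \<longlonglongrightarrow> exp (- (norm (0 *\<^sub>R \<xi>))\<^sup>2 / 2)"
    unfolding gauss_def by (intro tendsto_intros LIMSEQ_inverse_real_of_nat) simp
  then show ?thesis by simp
qed

text \<open>Fatou's lemma in the form used twice: to remove the Gaussian weight, and to pass to the
  limit in the completeness argument.\<close>

lemma nn_integral_le_of_tendsto:
  fixes u :: "nat \<Rightarrow> 'a \<Rightarrow> ennreal"
  assumes "\<And>k. u k \<in> borel_measurable M" and lim: "AE x in M. (\<lambda>k. u k x) \<longlonglongrightarrow> f x"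
    and le: "eventually (\<lambda>k. integral\<^sup>N M (u k) \<le> c) sequentially"
  shows "integral\<^sup>N M f \<le> c"
proof -
  have "integral\<^sup>N M f = (\<integral>\<^sup>+ x. liminf (\<lambda>k. u k x) \<partial>M)"
    using lim by (intro nn_integral_cong_AE) (auto simp: lim_imp_Liminf)
  also have "\<dots> \<le> liminf (\<lambda>k. integral\<^sup>N M (u k))"
    by (rule nn_integral_liminf) fact
  also have "\<dots> \<le> liminf (\<lambda>k. c)"
    using le by (rule Liminf_mono)
  finally show ?thesis by (simp add: Liminf_const)
qed

text \<open>Bessel's inequality, by Fatou as the Gaussian weight tends to 1. The right-hand side may
  be infinite; this matters for line integrals, which are known to be integrable but not yet
  square-integrable.\<close>

lemma sq_int_ft_le:
  fixes F :: "'a::euclidean_space \<Rightarrow> complex"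
  assumes F: "integrable lborel F" and s: "\<bar>s\<bar> = 1"
  shows "sq_int lborel (ft s F) \<le> ennreal ((2 * pi) ^ DIM('a)) * sq_int lborel F"
proof -
  have 1: "sq_int lborel (ft 1 F) \<le> ennreal ((2 * pi) ^ DIM('a)) * sq_int lborel F"
    if F: "integrable lborel F" for F :: "'a::euclidean_space \<Rightarrow> complex"
  proof (rule nn_integral_le_of_tendsto[where u="\<lambda>k \<xi>. ennreal (gauss (inverse (real (Suc k)) *\<^sub>R \<xi>) * (cmod (ft 1 F \<xi>))\<^sup>2)"])
    have [measurable]: "F \<in> borel_measurable borel" using F by auto
    fix k
    show "(\<lambda>\<xi>. ennreal (gauss (inverse (real (Suc k)) *\<^sub>R \<xi>) * (cmod (ft 1 F \<xi>))\<^sup>2)) \<in> borel_measurable lborel"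
      by measurable
  next
    show "AE \<xi> in lborel. (\<lambda>k. ennreal (gauss (inverse (real (Suc k)) *\<^sub>R \<xi>) * (cmod (ft 1 F \<xi>))\<^sup>2)) \<longlonglongrightarrow>
        ennreal ((cmod (ft 1 F \<xi>))\<^sup>2)"
      using tendsto_mult_right[OF tendsto_gauss_scaled] by (intro AE_I2 tendsto_ennrealI) fastforce
    show "\<forall>\<^sub>F k in sequentially. (\<integral>\<^sup>+ \<xi>. ennreal (gauss (inverse (real (Suc k)) *\<^sub>R \<xi>) * (cmod (ft 1 F \<xi>))\<^sup>2) \<partial>lborel)
        \<le> ennreal ((2 * pi) ^ DIM('a)) * sq_int lborel F"
      by (intro always_eventually allI sq_int_ft_gauss_le F) simp
  qed
  show ?thesis
  proof (cases "s = 1")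
    case False
    \<comment> \<open>Conjugating \<open>F\<close> reverses the sign of the exponent without
      changing either norm.\<close>
    then have "s = - 1" using s by linarith
    then have "cmod (ft s F \<xi>) = cmod (ft 1 (\<lambda>x. cnj (F x)) \<xi>)" for \<xi>
      using ft_cnj[of 1 "\<lambda>x. cnj (F x)" \<xi>] by simp
    then show ?thesis using 1[of "\<lambda>x. cnj (F x)"] F by simp
  qed (use 1 F in simp)
qed

lemma ft_L2:
  assumes "integrable lborel F" "F \<in> L2 lborel" "\<bar>s\<bar> = 1"
  shows "ft s F \<in> L2 lborel"
proof -
  have "F \<in> borel_measurable borel" using assms by auto
  then show ?thesis
    using assms sq_int_ft_le[OF assms(1,3)] unfolding L2_iff
    by (auto simp: ennreal_mult_less_top intro: le_less_trans)
qed

text \<open>At a continuity point y of \<open>\<phi>\<close> the Gaussian averages converge to a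
  multiple of \<open>\<phi> y\<close>, so almost everywhere continuity and the bound 1 replace the
  theory of approximate identities. The pairing is bilinear: opposite signs of the exponents take
  the place of a conjugate.\<close>

lemma parseval_continuous:
  fixes F \<phi> :: "'a::euclidean_space \<Rightarrow> complex"
  assumes F: "integrable lborel F" "F \<in> L2 lborel"
    and \<phi>: "integrable lborel \<phi>" "\<phi> \<in> L2 lborel" "\<And>x. cmod (\<phi> x) \<le> 1"
    and cont: "AE x in lborel. isCont \<phi> x"
  shows "(LINT \<xi>|lborel. ft 1 F \<xi> * ft (-1) \<phi> \<xi>) = (2 * pi) ^ DIM('a) * (LINT x|lborel. F x * \<phi> x)"
proof -
  have [measurable]: "F \<in> borel_measurable borel" "\<phi> \<in> borel_measurable borel"
    using F \<phi> by auto
  define C where "C = sqrt (2 * pi) ^ DIM('a)"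
  have C: "C \<ge> 0" "C * C = (2 * pi) ^ DIM('a)"
    by (auto simp: C_def sqrt_two_pi_power)
  define e where "e k = inverse (real (Suc k))" for k
  have e: "e k > 0" for k by (simp add: e_def)
  \<comment> \<open>On the frequency side the dominating function is the product of the two
    transforms, integrable because Bessel puts both in L2.\<close>
  have "(\<lambda>k. LINT \<xi>|lborel. gauss (e k *\<^sub>R \<xi>) * ft (-1) \<phi> \<xi> * ft 1 F \<xi>) \<longlonglongrightarrow>
      (LINT \<xi>|lborel. ft (-1) \<phi> \<xi> * ft 1 F \<xi>)"
  proof (rule integral_dominated_convergence)
    show "integrable lborel (\<lambda>\<xi>. norm (ft (-1) \<phi> \<xi> * ft 1 F \<xi>))"
      by (intro integrable_norm integrable_L2_mult ft_L2 F \<phi>) auto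
    have "(\<lambda>k. of_real (gauss (e k *\<^sub>R \<xi>)) * (ft (-1) \<phi> \<xi> * ft 1 F \<xi>)) \<longlonglongrightarrow> complex_of_real 1 * (ft (-1) \<phi> \<xi> * ft 1 F \<xi>)" for \<xi>
      unfolding e_def by (intro tendsto_intros tendsto_gauss_scaled)
    then show "AE \<xi> in lborel. (\<lambda>k. of_real (gauss (e k *\<^sub>R \<xi>)) * ft (-1) \<phi> \<xi> * ft 1 F \<xi>) \<longlonglongrightarrow> ft (-1) \<phi> \<xi> * ft 1 F \<xi>"
      by (simp add: mult.assoc)
  qed (auto simp: norm_mult mult.assoc intro!: mult_left_le_one_le)
  \<comment> \<open>On the space side the inner average is at most the mass \<open>C\<close> of the
    Gaussian, so a multiple of the modulus of \<open>F\<close> dominates.\<close>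
  moreover have "(\<lambda>k. C * (LINT y|lborel. F y * (LINT z|lborel. \<phi> (y - e k *\<^sub>R z) * gauss z))) \<longlonglongrightarrow>
      C * (LINT y|lborel. F y * (\<phi> y * C))"
  proof (intro tendsto_intros integral_dominated_convergence)
    show "integrable lborel (\<lambda>y. norm (F y * C))"
      by (intro integrable_norm integrable_mult_left F)
    show "AE y in lborel. (\<lambda>k. F y * (LINT z|lborel. \<phi> (y - e k *\<^sub>R z) * gauss z)) \<longlonglongrightarrow> F y * (\<phi> y * C)"
      using cont
    proof eventually_elim
      fix y assume y: "isCont \<phi> y"
      have "(\<lambda>k. LINT z|lborel. \<phi> (y - e k *\<^sub>R z) * gauss z) \<longlonglongrightarrow> (LINT z|lborel. \<phi> y * gauss (z::'a))"
      proof (rule integral_dominated_convergence)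
        show "integrable lborel (gauss :: 'a \<Rightarrow> real)" by (rule integrable_gauss_real)
        have "(\<lambda>k. y - e k *\<^sub>R z) \<longlonglongrightarrow> y - 0 *\<^sub>R z" for z
          unfolding e_def by (intro tendsto_intros LIMSEQ_inverse_real_of_nat)
        then have "(\<lambda>k. \<phi> (y - e k *\<^sub>R z)) \<longlonglongrightarrow> \<phi> y" for z
          by (intro isCont_tendsto_compose[OF y]) simp
        then show "AE z in lborel. (\<lambda>k. \<phi> (y - e k *\<^sub>R z) * complex_of_real (gauss z)) \<longlonglongrightarrow> \<phi> y * complex_of_real (gauss z)"
          by (intro AE_I2 tendsto_intros)
        show "AE z in lborel. norm (\<phi> (y - e k *\<^sub>R z) * complex_of_real (gauss z)) \<le> gauss z" for k
          using \<phi>(3) by (auto simp: norm_mult intro!: mult_left_le_one_le)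
      qed auto
      also have "(LINT z|lborel. \<phi> y * complex_of_real (gauss (z::'a))) = \<phi> y * C"
        by (simp add: integral_gauss C_def)
      finally show "(\<lambda>k. F y * (LINT z|lborel. \<phi> (y - e k *\<^sub>R z) * gauss z)) \<longlonglongrightarrow> F y * (\<phi> y * C)"
        by (intro tendsto_intros)
    qed
    show "AE y in lborel. norm (F y * (LINT z|lborel. \<phi> (y - e k *\<^sub>R z) * gauss z)) \<le> norm (F y * C)" for k
    proof (rule AE_I2)
      fix y
      have "norm (LINT z|lborel. \<phi> (y - e k *\<^sub>R z) * gauss z) \<le> (LINT z|lborel. gauss (z::'a))"
      proof (rule Bochner_Integration.integral_norm_bound_integral)
        show "integrable lborel (\<lambda>z. \<phi> (y - e k *\<^sub>R z) * complex_of_real (gauss z))"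
          by (rule Bochner_Integration.integrable_bound[OF integrable_gauss_real])
             (use \<phi>(3) in \<open>auto simp: norm_mult intro!: mult_left_le_one_le\<close>)
      qed (use \<phi>(3) integrable_gauss_real in \<open>auto simp: norm_mult intro!: mult_left_le_one_le\<close>)
      then show "norm (F y * (LINT z|lborel. \<phi> (y - e k *\<^sub>R z) * gauss z)) \<le> norm (F y * C)"
        using C(1) by (auto simp: norm_mult norm_power integral_gauss C_def intro!: mult_left_mono)
    qed
  qed auto
  ultimately have "(LINT \<xi>|lborel. ft (-1) \<phi> \<xi> * ft 1 F \<xi>) = C * (LINT y|lborel. F y * (\<phi> y * C))"
    using integral_ft_mult_gauss(2)[OF F(1) \<phi>(1) e] by (simp add: C_def LIMSEQ_unique)
  also have "(LINT y|lborel. F y * (\<phi> y * C)) = (LINT y|lborel. F y * \<phi> y) * C"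
    by (subst integral_mult_left_zero[symmetric]) (simp add: mult_ac)
  finally show ?thesis
    using C(2) by (simp add: mult_ac flip: of_real_mult of_real_power)
qed

section \<open>Fourier inversion in \<open>L\<^sup>2\<close>\<close>

text \<open>Along radii with \<open>B \<le> 4\<^sup>-\<^sup>k\<close>, the weighted sum of squared increments \<open>\<Sum>k. 2^k * |d k|\<^sup>2\<close> has
  finite integral, which gives pointwise convergence; Fatou's lemma then gives norm convergence.\<close>

lemma L2_complete:
  fixes u :: "real \<Rightarrow> 'a \<Rightarrow> complex"
  assumes u: "\<And>r. u r \<in> L2 M"
    and B: "\<And>r r'. r \<le> r' \<Longrightarrow> sq_int M (\<lambda>x. u r' x - u r x) \<le> B r" and lim: "(B \<longlongrightarrow> 0) at_top"
  shows "\<exists>g\<in>L2 M. ((\<lambda>r. sq_int M (\<lambda>x. u r x - g x)) \<longlongrightarrow> 0) at_top"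
proof -
  have [measurable]: "u r \<in> borel_measurable M" for r
    using u[of r] by (simp add: L2_iff)
  have "\<exists>R. \<forall>r\<ge>R. B r \<le> ennreal ((1 / 4) ^ k)" for k
  proof -
    have "eventually (\<lambda>r. B r < ennreal ((1 / 4) ^ k)) at_top"
      by (intro order_tendstoD[OF lim]) simp
    then show ?thesis by (auto simp: eventually_at_top_linorder intro: less_imp_le)
  qed
  then obtain R where R: "\<And>k r. R k \<le> r \<Longrightarrow> B r \<le> ennreal ((1 / 4) ^ k)" by metis
  \<comment> \<open>The summand k drives the radii to infinity; the partial sums make them
    increasing and keep them above \<open>R k\<close>.\<close>
  define r where "r k = real k + (\<Sum>j\<le>k. \<bar>R j\<bar>)" for k
  have r_Suc: "r k \<le> r (Suc k)" and r_ge: "real k \<le> r k" for k by (auto simp: r_def sum_nonneg)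
  have R_le: "R k \<le> r k" for k
  proof -
    have "\<bar>R k\<bar> \<le> (\<Sum>j\<le>k. \<bar>R j\<bar>)" by (rule member_le_sum) auto
    then show ?thesis by (simp add: r_def)
  qed
  define d where "d k x = u (r (Suc k)) x - u (r k) x" for k x
  have [measurable]: "d k \<in> borel_measurable M" for k unfolding d_def[abs_def] by measurable
  have d_le: "sq_int M (d k) \<le> ennreal ((1 / 4) ^ k)" for k
    unfolding d_def by (rule order_trans[OF B R]) (rule r_Suc, rule R_le)
  have "(\<integral>\<^sup>+ x. (\<Sum>k. ennreal (2 ^ k * (cmod (d k x))\<^sup>2)) \<partial>M) = (\<Sum>k. ennreal (2 ^ k) * sq_int M (d k))"
    by (subst nn_integral_suminf) (auto simp: ennreal_mult nn_integral_cmult)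
  also have "\<dots> \<le> (\<Sum>k. ennreal ((1 / 2) ^ k))"
  proof (intro suminf_le summableI)
    fix k
    have "ennreal (2 ^ k) * sq_int M (d k) \<le> ennreal (2 ^ k) * ennreal ((1 / 4) ^ k)"
      by (intro mult_left_mono d_le) simp
    also have "\<dots> = ennreal ((1 / 2) ^ k)"
      by (subst ennreal_mult[symmetric]) (auto simp flip: power_mult_distrib)
    finally show "ennreal (2 ^ k) * sq_int M (d k) \<le> ennreal ((1 / 2) ^ k)" .
  qed
  also have "\<dots> = ennreal (1 / (1 - 1 / 2))"
    by (intro suminf_ennreal_eq geometric_sums) auto
  finally have "(\<integral>\<^sup>+ x. (\<Sum>k. ennreal (2 ^ k * (cmod (d k x))\<^sup>2)) \<partial>M) \<noteq> \<infinity>"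
    by (auto simp: top_unique)
  then have "AE x in M. (\<Sum>k. ennreal (2 ^ k * (cmod (d k x))\<^sup>2)) \<noteq> \<infinity>"
    by (intro nn_integral_PInf_AE) auto
  then have conv: "AE x in M. convergent (\<lambda>k. u (r k) x)"
  proof eventually_elim
    fix x assume x: "(\<Sum>k. ennreal (2 ^ k * (cmod (d k x))\<^sup>2)) \<noteq> \<infinity>"
    define e where "e = (\<lambda>k. ennreal (2 ^ k * (cmod (d k x))\<^sup>2))"
    define S where "S = enn2real (suminf e)"
    have S: "ennreal S = suminf e" "S \<ge> 0"
      using x by (simp_all add: S_def ennreal_enn2real_if e_def)
    \<comment> \<open>A single term of the weighted series is at most its sum \<open>S\<close>, so
      the increments decay geometrically with ratio sqrt (1 / 2).\<close>
    have bound: "norm (d k x) \<le> sqrt S * sqrt (1 / 2) ^ k" for k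
    proof (rule power2_le_imp_le)
      have "sum e {k} \<le> suminf e" by (rule sum_le_suminf) auto
      then have "ennreal (2 ^ k * (cmod (d k x))\<^sup>2) \<le> ennreal S"
        unfolding S(1) by (simp add: e_def)
      then have "2 ^ k * (cmod (d k x))\<^sup>2 \<le> S" using S(2) by (simp add: ennreal_le_iff)
      moreover have "(sqrt S * sqrt (1 / 2) ^ k)\<^sup>2 = S * (1 / 2) ^ k"
        using S(2) by (simp add: power_mult_distrib power_even_eq[symmetric] power_mult[symmetric] mult.commute[of _ 2])
          (simp add: power_mult)
      moreover have "(cmod (d k x))\<^sup>2 \<le> S * (1 / 2) ^ k" if "2 ^ k * (cmod (d k x))\<^sup>2 \<le> S"
        using that by (simp add: field_simps power_one_over)
      ultimately show "(norm (d k x))\<^sup>2 \<le> (sqrt S * sqrt (1 / 2) ^ k)\<^sup>2"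
        by metis
    qed (use S(2) in auto)
    have "summable (\<lambda>k. sqrt S * sqrt (1 / 2) ^ k)"
      by (intro summable_mult summable_geometric) simp
    then have "summable (\<lambda>k. d k x)"
      by (rule summable_comparison_test'[where N=0]) (rule bound)
    then have "convergent (\<lambda>k. (\<Sum>i<k. d i x))"
      by (simp add: summable_iff_convergent)
    moreover have "(\<Sum>i<k. d i x) = u (r k) x - u (r 0) x" for k
      unfolding d_def by (rule sum_lessThan_telescope)
    ultimately have "convergent (\<lambda>k. (u (r k) x - u (r 0) x) + u (r 0) x)"
      by (intro convergent_add convergent_const) simp
    then show "convergent (\<lambda>k. u (r k) x)" by simp
  qed
  define g where "g x = lim (\<lambda>k. u (r k) x)" for x
  have [measurable]: "g \<in> borel_measurable M"
    unfolding g_def[abs_def] by (rule borel_measurable_lim_metric) simp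
  \<comment> \<open>With q fixed, the radii \<open>r k\<close> eventually exceed q and Fatou applies
    along them. Since q is arbitrary, the bound and hence the convergence hold along all radii, not
    only along the subsequence.\<close>
  have key: "sq_int M (\<lambda>x. u q x - g x) \<le> B q" for q
  proof (rule nn_integral_le_of_tendsto)
    show "(\<lambda>x. ennreal ((cmod (u q x - u (r k) x))\<^sup>2)) \<in> borel_measurable M" for k
      by measurable
    show "AE x in M. (\<lambda>k. ennreal ((cmod (u q x - u (r k) x))\<^sup>2)) \<longlonglongrightarrow> ennreal ((cmod (u q x - g x))\<^sup>2)"
      using conv by eventually_elim (auto simp: convergent_LIMSEQ_iff g_def intro!: tendsto_intros tendsto_ennrealI)
    show "\<forall>\<^sub>F k in sequentially. sq_int M (\<lambda>x. u q x - u (r k) x) \<le> B q"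
      using eventually_ge_at_top[of "nat \<lceil>q\<rceil>"]
    proof eventually_elim
      case (elim k)
      then have "q \<le> r k" using r_ge[of k] by linarith
      from B[OF this] show ?case by (subst norm_minus_commute)
    qed
  qed
  have tend: "((\<lambda>r. sq_int M (\<lambda>x. u r x - g x)) \<longlongrightarrow> 0) at_top"
    by (rule tendsto_sandwich[OF _ _ tendsto_const lim]) (auto simp: key)
  have "eventually (\<lambda>r. sq_int M (\<lambda>x. u r x - g x) < 1) at_top"
    by (intro order_tendstoD[OF tend]) simp
  then obtain q where "sq_int M (\<lambda>x. u q x - g x) < 1"
    by (auto simp: eventually_at_top_linorder)
  then have "(\<lambda>x. u q x - g x) \<in> L2 M"
    unfolding L2_iff by (auto intro: less_trans)
  from L2_diff[OF u[of q] this] have "g \<in> L2 M" by simp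
  with tend show ?thesis by blast
qed

section \<open>Truncation to balls and the existence of the L2 Fourier limit\<close>

definition cut :: "real \<Rightarrow> ('a::euclidean_space \<Rightarrow> complex) \<Rightarrow> 'a \<Rightarrow> complex" where
  "cut r f x = indicator (ball 0 r) x *\<^sub>R f x"

lemma cut_L2: "f \<in> L2 lborel \<Longrightarrow> cut r f \<in> L2 lborel"
proof -
  assume f: "f \<in> L2 lborel"
  then have [measurable]: "f \<in> borel_measurable borel" by (simp add: L2_iff)
  have "cut r f \<in> borel_measurable borel"
    unfolding cut_def[abs_def] by (intro borel_measurable_scaleR borel_measurable_indicator) auto
  moreover have "sq_int lborel (cut r f) \<le> sq_int lborel f"
    by (intro nn_integral_mono) (auto simp: cut_def indicator_def)
  ultimately show ?thesis
    using f unfolding L2_iff by (auto intro: le_less_trans)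
qed

text \<open>On a ball, which has finite measure, the modulus is bounded by 1 plus its square.
  Truncation therefore makes the Fourier integral absolutely convergent.\<close>

lemma integrable_cut:
  fixes f :: "'a::euclidean_space \<Rightarrow> complex"
  assumes f: "f \<in> L2 lborel"
  shows "integrable lborel (cut r f)"
proof (rule Bochner_Integration.integrable_bound)
  have "integrable lborel (indicat_real (ball (0::'a) r))"
    using emeasure_lborel_ball_finite[of "0::'a" r] by (intro integrable_real_indicator) simp_all
  then show "integrable lborel (\<lambda>x. indicat_real (ball 0 r) x + (cmod (f x))\<^sup>2)"
    using integrable_L2_sq[OF f] by simp
  show "cut r f \<in> borel_measurable lborel"
    using cut_L2[OF f] by (simp add: L2_iff)
  have "a \<le> 1 + a\<^sup>2" for a :: real
    using zero_le_power2[of "a - 1 / 2"] by (simp add: power2_eq_square algebra_simps)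
  then show "AE x in lborel. norm (cut r f x) \<le> norm (indicat_real (ball 0 r) x + (cmod (f x))\<^sup>2)"
    by (auto simp: cut_def indicator_def)
qed

lemma tail_tendsto:
  fixes f :: "'a::euclidean_space \<Rightarrow> complex"
  assumes f: "f \<in> L2 lborel"
  shows "((\<lambda>r. \<integral>\<^sup>+ x. indicator (- ball 0 r) x * ennreal ((cmod (f x))\<^sup>2) \<partial>lborel) \<longlongrightarrow> 0) at_top"
proof -
  have [measurable]: "f \<in> borel_measurable borel" using f by (simp add: L2_iff)
  note int = integrable_L2_sq[OF f]
  have "((\<lambda>r. LINT x|lborel. indicator (- ball 0 r) x * (cmod (f x))\<^sup>2) \<longlongrightarrow> integral\<^sup>L lborel (\<lambda>_::'a. 0::real)) at_top"
  proof (rule integral_dominated_convergence_at_top[where w="\<lambda>x. (cmod (f x))\<^sup>2" and f="\<lambda>x. 0" and s="\<lambda>r x. indicator (- ball 0 r) x * (cmod (f x))\<^sup>2"])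
    show "integrable lborel (\<lambda>x. (cmod (f x))\<^sup>2)" by (rule int)
  next
    show "AE x in lborel. ((\<lambda>r. indicator (- ball 0 r) x * (cmod (f x))\<^sup>2) \<longlongrightarrow> 0) at_top"
    proof (rule AE_I2)
      fix x
      have "eventually (\<lambda>r. indicator (- ball 0 r) x * (cmod (f x))\<^sup>2 = 0) at_top"
        using eventually_gt_at_top[of "norm x"] by eventually_elim auto
      then show "((\<lambda>r. indicator (- ball 0 r) x * (cmod (f x))\<^sup>2) \<longlongrightarrow> 0) at_top"
        by (rule tendsto_eventually)
    qed
  qed (auto simp: indicator_def)
  then have "((\<lambda>r. ennreal (LINT x|lborel. indicator (- ball 0 r) x * (cmod (f x))\<^sup>2)) \<longlongrightarrow> ennreal 0) at_top"
    by (intro tendsto_ennrealI) simp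
  moreover have "ennreal (LINT x|lborel. indicator (- ball 0 r) x * (cmod (f x))\<^sup>2) =
      (\<integral>\<^sup>+ x. indicator (- ball 0 r) x * ennreal ((cmod (f x))\<^sup>2) \<partial>lborel)" for r
  proof -
    have "integrable lborel (\<lambda>x. indicator (- ball 0 r) x * (cmod (f x))\<^sup>2)"
      by (rule Bochner_Integration.integrable_bound[OF int]) (auto simp: indicator_def)
    then have "ennreal (LINT x|lborel. indicator (- ball 0 r) x * (cmod (f x))\<^sup>2) =
       (\<integral>\<^sup>+ x. ennreal (indicator (- ball 0 r) x * (cmod (f x))\<^sup>2) \<partial>lborel)"
      by (intro nn_integral_eq_integral[symmetric]) auto
    also have "\<dots> = (\<integral>\<^sup>+ x. indicator (- ball 0 r) x * ennreal ((cmod (f x))\<^sup>2) \<partial>lborel)"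
      by (intro nn_integral_cong) (auto simp: indicator_def)
    finally show ?thesis .
  qed
  ultimately show ?thesis by simp
qed

lemma cut_tendsto:
  assumes f: "f \<in> L2 lborel"
  shows "((\<lambda>r. sq_int lborel (\<lambda>x. cut r f x - f x)) \<longlongrightarrow> 0) at_top"
  by (rule tendsto_sandwich[OF _ _ tendsto_const tail_tendsto[OF f]])
     (auto intro!: always_eventually nn_integral_mono simp: cut_def indicator_def)

text \<open>Bessel applied to the difference of two truncations bounds it by the tail of
  \<open>F\<close> outside the smaller ball, which is the Cauchy estimate that
  \<open>L2_complete\<close> asks for.\<close>

lemma ft_cut_limit_exists:
  fixes F :: "'a::euclidean_space \<Rightarrow> complex"
  assumes F: "F \<in> L2 lborel" and s: "\<bar>s\<bar> = 1"
  shows "\<exists>g\<in>L2 lborel. ((\<lambda>r. sq_int lborel (\<lambda>\<xi>. ft s (cut r F) \<xi> - g \<xi>)) \<longlongrightarrow> 0) at_top"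
proof (rule L2_complete)
  let ?T = "\<lambda>r. \<integral>\<^sup>+ x. indicator (- ball 0 r) x * ennreal ((cmod (F x))\<^sup>2) \<partial>lborel"
  show "ft s (cut r F) \<in> L2 lborel" for r
    by (intro ft_L2 integrable_cut cut_L2 F s)
  show "sq_int lborel (\<lambda>\<xi>. ft s (cut r' F) \<xi> - ft s (cut r F) \<xi>) \<le> ennreal ((2 * pi) ^ DIM('a)) * ?T r"
    if "r \<le> r'" for r r'
  proof -
    have "sq_int lborel (\<lambda>\<xi>. ft s (cut r' F) \<xi> - ft s (cut r F) \<xi>) = sq_int lborel (ft s (\<lambda>x. cut r' F x - cut r F x))"
      by (simp add: ft_diff integrable_cut F)
    also have "\<dots> \<le> ennreal ((2 * pi) ^ DIM('a)) * sq_int lborel (\<lambda>x. cut r' F x - cut r F x)"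
      by (intro sq_int_ft_le s Bochner_Integration.integrable_diff integrable_cut F)
    also have "\<dots> \<le> ennreal ((2 * pi) ^ DIM('a)) * ?T r"
      using that by (intro mult_left_mono nn_integral_mono) (auto simp: cut_def indicator_def)
    finally show ?thesis .
  qed
  show "((\<lambda>r. ennreal ((2 * pi) ^ DIM('a)) * ?T r) \<longlongrightarrow> 0) at_top"
    using ennreal_tendsto_cmult[OF _ tail_tendsto[OF F], of "ennreal ((2 * pi) ^ DIM('a))"] by simp
qed

section \<open>Testing against boxes and the inversion theorem\<close>

lemma indicator_box_L2: "(\<lambda>x. indicator (box a b) x :: complex) \<in> L2 lborel" for a b :: "'a::euclidean_space"
proof -
  have "sq_int lborel (\<lambda>x. indicator (box a b) x :: complex) = (\<integral>\<^sup>+ x. indicator (box a b) x \<partial>lborel)"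
    by (intro nn_integral_cong) (auto simp: indicator_def)
  then show ?thesis using emeasure_lborel_box_finite[of a b] by (simp add: L2_iff)
qed

text \<open>Boxes form a generator of the Borel sets that is stable under intersection, so vanishing
  integrals spread to all Borel sets. \<open>H\<close> is only locally integrable, hence the
  localization to the cubes \<open>K n\<close>.\<close>

lemma L2_eq_zero_if_boxes:
  fixes H :: "'a::euclidean_space \<Rightarrow> complex"
  assumes H: "H \<in> L2 lborel" and boxes: "\<And>a b. (LINT x|lborel. H x * indicator (box a b) x) = 0"
  shows "AE x in lborel. H x = 0"
proof -
  define K where "K n = (box (- (real n *\<^sub>R One)) (real n *\<^sub>R One) :: 'a set)" for n :: nat
  have "AE x in lborel. H x * indicator (K n) x = 0" for n
  proof (rule sigma_finite_measure.density_zero[OF sigma_finite_lborel])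
    show int: "integrable lborel (\<lambda>x. H x * indicator (K n) x)"
      unfolding K_def by (intro integrable_L2_mult H indicator_box_L2)
    fix A :: "'a set" assume "A \<in> sets lborel"
    then have A: "A \<in> sigma_sets UNIV (range (\<lambda>(a, b). box a b))"
      by (simp add: borel_eq_box)
    have sint: "set_integrable lborel A (\<lambda>x. H x * indicator (K n) x)" if "A \<in> sets borel" for A
      using that int by (simp add: set_integrable_def integrable_mult_indicator)
    have "Int_stable (range (\<lambda>(a, b). box a b :: 'a set))"
      by (auto simp: Int_stable_def box_Int_box)
    moreover have "range (\<lambda>(a, b). box a b :: 'a set) \<subseteq> Pow UNIV" by simp
    ultimately show "(LINT x:A|lborel. H x * indicator (K n) x) = 0"
      using A
    proof (induction rule: sigma_sets_induct_disjoint)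
      case (basic A)
      then obtain a b where "A = box a b" by auto
      \<comment> \<open>Intersecting with the cube gives a box again, so the hypothesis also covers
        the localized function.\<close>
      then obtain c d where "A \<inter> K n = box c d" by (simp add: K_def box_Int_box)
      then have "(LINT x:A|lborel. H x * indicator (K n) x) = (LINT x|lborel. H x * indicator (box c d) x)"
        unfolding set_lebesgue_integral_def
        by (intro Bochner_Integration.integral_cong) (auto simp: indicator_def)
      then show ?case using boxes by simp
    next
      case (compl A)
      then have [measurable]: "A \<in> sets borel" by (simp add: borel_eq_box)
      have "(LINT x:A|lborel. H x * indicator (K n) x) + (LINT x:UNIV - A|lborel. H x * indicator (K n) x) =
          (LINT x:A \<union> (UNIV - A)|lborel. H x * indicator (K n) x)"
        by (intro set_integral_Un[symmetric] sint) auto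
      \<comment> \<open>The integral over the whole space is the one over the cube
        \<open>K n\<close>, itself a box.\<close>
      also have "\<dots> = 0"
        using boxes by (simp add: set_lebesgue_integral_def K_def)
      finally show ?case using compl by simp
    next
      case (union A)
      then have [measurable]: "A i \<in> sets borel" for i by (auto simp: borel_eq_box)
      have "(LINT x:\<Union>(range A)|lborel. H x * indicator (K n) x) = (\<Sum>i. LINT x:A i|lborel. H x * indicator (K n) x)"
        using union(1) by (intro lebesgue_integral_countable_add sint) (auto simp: disjoint_family_on_def)
      then show ?case using union by simp
    qed (auto simp: set_lebesgue_integral_def)
  qed
  then have "AE x in lborel. \<forall>n. H x * indicator (K n) x = 0"
    unfolding AE_all_countable by blast
  then show ?thesis
  proof eventually_elim
    fix x assume x: "\<forall>n. H x * indicator (K n) x = 0"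
    obtain n where "x \<in> K n" using UN_box_eq_UNIV by (auto simp: K_def)
    with x show "H x = 0" by (metis indicator_simps(1) mult.right_neutral)
  qed
qed

text \<open>The limits \<open>h\<close> and \<open>G\<close> enter as hypotheses, which keeps the
  choice operator out of the argument. With \<open>k\<close> the transform of a box indicator,
  duality gives equal pairings of \<open>G\<close> with the box and of \<open>h\<close> with
  \<open>k\<close>; Parseval for the truncations of \<open>F\<close> gives equal pairings of
  \<open>h\<close> with \<open>k\<close> and of \<open>F\<close> with the box.\<close>

theorem fourier_inversion_L2:
  fixes F h G :: "'a::euclidean_space \<Rightarrow> complex"
  assumes F: "F \<in> L2 lborel" and h: "h \<in> L2 lborel" and G: "G \<in> L2 lborel"
    and Fh: "((\<lambda>r. sq_int lborel (\<lambda>x. ft 1 (cut r F) x / complex_of_real ((2 * pi) ^ DIM('a)) - h x)) \<longlongrightarrow> 0) at_top"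
    and hG: "((\<lambda>r. sq_int lborel (\<lambda>x. ft (-1) (cut r h) x - G x)) \<longlongrightarrow> 0) at_top"
  shows "AE x in lborel. G x = F x"
proof -
  define c where "c = complex_of_real ((2 * pi) ^ DIM('a))"
  have c: "c \<noteq> 0" by (simp add: c_def)
  have test: "(LINT x|lborel. G x * indicator (box a b) x) = (LINT x|lborel. F x * indicator (box a b) x)" for a b
  proof -
    define \<phi> :: "'a \<Rightarrow> complex" where "\<phi> = indicator (box a b)"
    have [measurable]: "\<phi> \<in> borel_measurable borel" by (simp add: \<phi>_def)
    have \<phi>_L2: "\<phi> \<in> L2 lborel"
      unfolding \<phi>_def by (rule indicator_box_L2)
    have \<phi>_int: "integrable lborel \<phi>"
    proof -
      have "(\<lambda>x. \<phi> x * \<phi> x) = \<phi>" by (auto simp: \<phi>_def indicator_def fun_eq_iff)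
      with integrable_L2_mult[OF \<phi>_L2 \<phi>_L2] show ?thesis by simp
    qed
    \<comment> \<open>The only discontinuities lie on the boundary of the box, a null set; this is
      why boxes qualify for \<open>parseval_continuous\<close>.\<close>
    have cont: "AE x in lborel. isCont \<phi> x"
    proof -
      have "AE x in lborel. x \<notin> cbox a b - box a b"
        by (rule AE_not_in[OF null_sets_cbox_Diff_box])
      then show ?thesis
      proof eventually_elim
        fix x assume "x \<notin> cbox a b - box a b"
        then consider "x \<in> box a b" | "x \<in> - cbox a b" by auto
        then show "isCont \<phi> x"
        proof cases
          case 1
          have "continuous_on (box a b) \<phi>"
            by (rule continuous_on_eq[OF continuous_on_const[of _ 1]]) (simp add: \<phi>_def)
          with 1 show ?thesis using continuous_on_eq_continuous_at[OF open_box] by blast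
        next
          case 2
          have "continuous_on (- cbox a b) \<phi>"
            by (rule continuous_on_eq[OF continuous_on_const[of _ 0]]) (use box_subset_cbox[of a b] in \<open>auto simp: \<phi>_def indicator_def\<close>)
          moreover have "open (- cbox a b)" by (simp add: closed_cbox open_Compl)
          ultimately show ?thesis using 2 continuous_on_eq_continuous_at by blast
        qed
      qed
    qed
    define k where "k = ft (-1) \<phi>"
    have k: "k \<in> L2 lborel" unfolding k_def by (intro ft_L2 \<phi>_int \<phi>_L2) auto
    have 1: "((\<lambda>r. LINT x|lborel. ft (-1) (cut r h) x * \<phi> x) \<longlongrightarrow> (LINT x|lborel. G x * \<phi> x)) at_top"
      by (intro tendsto_integral_L2_mult hG G \<phi>_L2 ft_L2 integrable_cut cut_L2 h) auto
    have "(LINT x|lborel. ft (-1) (cut r h) x * \<phi> x) = (LINT x|lborel. cut r h x * k x)" for r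
      using ft_multiplication[OF \<phi>_int integrable_cut[OF h, of r], of "-1"] by (simp add: k_def mult.commute)
    moreover have "((\<lambda>r. LINT x|lborel. cut r h x * k x) \<longlongrightarrow> (LINT x|lborel. h x * k x)) at_top"
      by (intro tendsto_integral_L2_mult cut_tendsto h cut_L2 k)
    ultimately have G_eq: "(LINT x|lborel. G x * \<phi> x) = (LINT x|lborel. h x * k x)"
      using 1 by (auto intro: tendsto_unique[OF trivial_limit_at_top_linorder])
    have "((\<lambda>r. LINT x|lborel. (ft 1 (cut r F) x / c) * k x) \<longlongrightarrow> (LINT x|lborel. h x * k x)) at_top"
    proof (intro tendsto_integral_L2_mult k h)
      show "(\<lambda>x. ft 1 (cut r F) x / c) \<in> L2 lborel" for r
      proof -
        have ft: "ft 1 (cut r F) \<in> L2 lborel" by (intro ft_L2 integrable_cut cut_L2 F) auto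
        have "sq_int lborel (\<lambda>x. ft 1 (cut r F) x / c) = ennreal (1 / (cmod c)\<^sup>2) * sq_int lborel (ft 1 (cut r F))"
          using ft by (subst nn_integral_cmult[symmetric])
            (auto simp: L2_iff norm_divide power_divide ennreal_mult[symmetric] intro!: nn_integral_cong)
        with ft show ?thesis by (auto simp: L2_iff ennreal_mult_less_top)
      qed
    qed (use Fh in \<open>simp add: c_def\<close>)
    moreover have "(LINT x|lborel. (ft 1 (cut r F) x / c) * k x) = (LINT x|lborel. cut r F x * \<phi> x)" for r
    proof -
      have "(LINT x|lborel. (ft 1 (cut r F) x / c) * k x) = (LINT x|lborel. ft 1 (cut r F) x * k x) / c"
        by (simp flip: integral_divide_zero)
      also have "\<dots> = c * (LINT x|lborel. cut r F x * \<phi> x) / c"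
        unfolding k_def c_def by (subst parseval_continuous[OF integrable_cut[OF F] cut_L2[OF F] \<phi>_int \<phi>_L2 _ cont]) (auto simp: \<phi>_def indicator_def)
      finally show ?thesis using c by simp
    qed
    moreover have "((\<lambda>r. LINT x|lborel. cut r F x * \<phi> x) \<longlongrightarrow> (LINT x|lborel. F x * \<phi> x)) at_top"
      by (intro tendsto_integral_L2_mult cut_tendsto F cut_L2 \<phi>_L2)
    ultimately have "(LINT x|lborel. h x * k x) = (LINT x|lborel. F x * \<phi> x)"
      by (auto intro: tendsto_unique[OF trivial_limit_at_top_linorder])
    with G_eq show ?thesis by (simp add: \<phi>_def)
  qed
  have "AE x in lborel. G x - F x = 0"
  proof (rule L2_eq_zero_if_boxes)
    show "(\<lambda>x. G x - F x) \<in> L2 lborel" by (intro L2_diff F G)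
    fix a b :: 'a
    from integrable_L2_mult[OF G indicator_box_L2] integrable_L2_mult[OF F indicator_box_L2] test
    show "(LINT x|lborel. (G x - F x) * indicator (box a b) x) = 0"
      by (simp add: left_diff_distrib)
  qed
  then show ?thesis by simp
qed

section \<open>Planar geometry and the Fourier slice theorem\<close>

lemma vector_2_eq: "vector [a, b] = a *\<^sub>R axis 1 1 + b *\<^sub>R (axis 2 1 :: real^2)"
  by (simp add: vec_eq_iff forall_2 axis_def)

text \<open>A Borel measure that gives boxes their volume is Lebesgue measure. This links the type
  \<open>real^2\<close> to iterated integrals.\<close>

lemma distr_vector_2: "distr (lborel \<Otimes>\<^sub>M lborel) borel (\<lambda>(x, y). vector [x, y] :: real^2) = lborel"
proof (rule lborel_eqI[symmetric])
  have [measurable]: "(\<lambda>(x, y). vector [x, y] :: real^2) \<in> borel_measurable (lborel \<Otimes>\<^sub>M lborel)"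
    unfolding lborel_prod case_prod_beta vector_2_eq
    by (auto intro!: borel_measurable_continuous_onI continuous_intros)
  fix l u :: "real^2" assume le: "\<And>b. b \<in> Basis \<Longrightarrow> l \<bullet> b \<le> u \<bullet> b"
  have "l $ i \<le> u $ i" for i
    using le[of "axis i 1"] by (auto simp: inner_axis Basis_vec_def)
  moreover have "(\<lambda>(x, y). vector [x, y] :: real^2) -` box l u \<inter> space (lborel \<Otimes>\<^sub>M lborel) =
      {l $ 1<..<u $ 1} \<times> {l $ 2<..<u $ 2}"
    by (auto simp: mem_box_cart forall_2 space_pair_measure)
  moreover have "(\<Prod>b\<in>Basis. (u - l) \<bullet> b) = (u $ 1 - l $ 1) * (u $ 2 - l $ 2)"
  proof -
    have B: "(Basis :: (real^2) set) = {axis 1 1, axis 2 1}"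
      by (auto simp: Basis_vec_def) (metis exhaust_2)
    show ?thesis unfolding B by (simp add: axis_eq_axis inner_axis)
  qed
  ultimately show "emeasure (distr (lborel \<Otimes>\<^sub>M lborel) borel (\<lambda>(x, y). vector [x, y] :: real^2)) (box l u) =
      (\<Prod>b\<in>Basis. (u - l) \<bullet> b)"
    by (simp add: emeasure_distr lborel.emeasure_pair_measure_Times ennreal_mult)
qed simp

lemma measurable_vector_2 [measurable (raw)]:
  assumes "f \<in> borel_measurable M" "g \<in> borel_measurable M"
  shows "(\<lambda>x. vector [f x, g x] :: real^2) \<in> borel_measurable M"
proof -
  have 1: "(\<lambda>z. vector [fst z, snd z] :: real^2) \<in> borel_measurable (borel \<Otimes>\<^sub>M borel)"
    unfolding borel_prod vector_2_eq by (auto intro!: borel_measurable_continuous_onI continuous_intros)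
  have 2: "(\<lambda>x. (f x, g x)) \<in> M \<rightarrow>\<^sub>M borel \<Otimes>\<^sub>M borel" using assms by simp
  from measurable_compose[OF 2 1] show ?thesis by simp
qed

lemma measurable_vec_nth_2 [measurable (raw)]:
  "f \<in> borel_measurable M \<Longrightarrow> (\<lambda>x. (f x :: real^2) $ i) \<in> borel_measurable M"
  by (rule measurable_compose[of f M borel "\<lambda>x. x $ i"])
     (simp_all add: borel_measurable_continuous_onI continuous_on_component)

lemma nn_integral_real_2:
  fixes g :: "real^2 \<Rightarrow> ennreal"
  assumes [measurable]: "g \<in> borel_measurable borel"
  shows "(\<integral>\<^sup>+ z. g z \<partial>lborel) = (\<integral>\<^sup>+ x. \<integral>\<^sup>+ y. g (vector [x, y]) \<partial>lborel \<partial>lborel)"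
  by (subst distr_vector_2[symmetric], subst nn_integral_distr)
     (auto simp: lborel.nn_integral_fst[symmetric] case_prod_beta)

lemma circle_point_nth [simp]: "circle_point \<theta> $ 1 = cos \<theta>" "circle_point \<theta> $ 2 = sin \<theta>"
  by (simp_all add: circle_point_def)

lemma perp_nth [simp]: "perp v $ 1 = - v $ 2" "perp v $ 2 = v $ 1"
  by (simp_all add: perp_def)

lemma norm_real_2: "norm (z :: real^2) = sqrt ((z $ 1)\<^sup>2 + (z $ 2)\<^sup>2)"
  by (simp add: norm_vec_def L2_set_def sum_2)

lemma inner_real_2: "(z :: real^2) \<bullet> w = z $ 1 * w $ 1 + z $ 2 * w $ 2"
  by (simp add: inner_vec_def sum_2)

lemma norm_circle_point [simp]: "norm (circle_point \<theta>) = 1"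
  by (simp add: norm_real_2)

lemma continuous_circle_point: "continuous_on S circle_point"
  unfolding circle_point_def[abs_def] vector_2_eq by (intro continuous_intros)

lemma measurable_circle_point [measurable]: "circle_point \<in> borel_measurable borel"
  by (rule borel_measurable_continuous_onI[OF continuous_circle_point])

lemma measurable_perp [measurable]: "perp \<in> borel_measurable borel"
  unfolding perp_def[abs_def] by measurable

lemma scaleR_circle_point_perp: "p *\<^sub>R circle_point \<theta> + t *\<^sub>R perp (circle_point \<theta>) =
    vector [p * cos \<theta> - t * sin \<theta>, p * sin \<theta> + t * cos \<theta>]"
  by (simp add: vec_eq_iff forall_2)

lemma scaleR_circle_point: "p *\<^sub>R circle_point \<theta> = vector [p * cos \<theta>, p * sin \<theta>]"
  by (simp add: vec_eq_iff forall_2)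

text \<open>For \<open>cos \<theta> > 0\<close> the rotation is a composition of two one-dimensional affine substitutions.\<close>

lemma distr_rotation:
  assumes c: "cos \<theta> > 0"
  shows "distr (lborel \<Otimes>\<^sub>M lborel) borel (\<lambda>(p, t). p *\<^sub>R circle_point \<theta> + t *\<^sub>R perp (circle_point \<theta>)) = lborel"
proof (rule measure_eqI)
  fix A assume "A \<in> sets (distr (lborel \<Otimes>\<^sub>M lborel) borel (\<lambda>(p, t). p *\<^sub>R circle_point \<theta> + t *\<^sub>R perp (circle_point \<theta>)))"
  then have [measurable]: "A \<in> sets borel" by simp
  define g :: "real^2 \<Rightarrow> ennreal" where "g = indicator A"
  have [measurable]: "g \<in> borel_measurable borel" by (simp add: g_def)
  have "emeasure (distr (lborel \<Otimes>\<^sub>M lborel) borel (\<lambda>(p, t). p *\<^sub>R circle_point \<theta> + t *\<^sub>R perp (circle_point \<theta>))) A =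
      (\<integral>\<^sup>+ p. \<integral>\<^sup>+ t. g (vector [p * cos \<theta> - t * sin \<theta>, p * sin \<theta> + t * cos \<theta>]) \<partial>lborel \<partial>lborel)"
    unfolding scaleR_circle_point_perp
    by (subst nn_integral_indicator[symmetric], simp, subst nn_integral_distr)
       (auto simp: lborel.nn_integral_fst[symmetric] case_prod_beta g_def)
  also have "\<dots> = (\<integral>\<^sup>+ t. \<integral>\<^sup>+ p. g (vector [p * cos \<theta> - t * sin \<theta>, p * sin \<theta> + t * cos \<theta>]) \<partial>lborel \<partial>lborel)"
    by (rule lborel_pair.Fubini') simp
  also have "\<dots> = (\<integral>\<^sup>+ t. \<integral>\<^sup>+ x. ennreal (1 / cos \<theta>) * g (vector [x, x * sin \<theta> / cos \<theta> + t / cos \<theta>]) \<partial>lborel \<partial>lborel)"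
  proof (rule nn_integral_cong)
    fix t :: real
    \<comment> \<open>The substitution p = (t * sin \<theta> + x) / cos \<theta> makes the first
      coordinate equal to x; by sin^2 + cos^2 = 1 the second becomes affine in t with slope 1 / cos
      \<theta>.\<close>
    have e1: "(t * sin \<theta> / cos \<theta> + 1 / cos \<theta> * x) * cos \<theta> - t * sin \<theta> = x" for x
      using c by (simp add: field_simps)
    have e2: "(t * sin \<theta> / cos \<theta> + 1 / cos \<theta> * x) * sin \<theta> + t * cos \<theta> = x * sin \<theta> / cos \<theta> + t / cos \<theta>" for x
    proof -
      have "(t * sin \<theta> / cos \<theta> + 1 / cos \<theta> * x) * sin \<theta> + t * cos \<theta> = (x * sin \<theta> + t * ((sin \<theta>)\<^sup>2 + (cos \<theta>)\<^sup>2)) / cos \<theta>"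
        using c by (simp add: field_simps power2_eq_square del: sin_cos_squared_add sin_cos_squared_add2 sin_cos_squared_add3)
      then show ?thesis by (simp add: add_divide_distrib)
    qed
    have "(\<integral>\<^sup>+ p. g (vector [p * cos \<theta> - t * sin \<theta>, p * sin \<theta> + t * cos \<theta>]) \<partial>lborel) =
      ennreal \<bar>1 / cos \<theta>\<bar> * (\<integral>\<^sup>+ x. g (vector [(t * sin \<theta> / cos \<theta> + 1 / cos \<theta> * x) * cos \<theta> - t * sin \<theta>,
          (t * sin \<theta> / cos \<theta> + 1 / cos \<theta> * x) * sin \<theta> + t * cos \<theta>]) \<partial>lborel)"
      using c by (intro nn_integral_real_affine) auto
    also have "\<dots> = ennreal \<bar>1 / cos \<theta>\<bar> * (\<integral>\<^sup>+ x. g (vector [x, x * sin \<theta> / cos \<theta> + t / cos \<theta>]) \<partial>lborel)"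
      unfolding e1 e2 ..
    finally show "(\<integral>\<^sup>+ p. g (vector [p * cos \<theta> - t * sin \<theta>, p * sin \<theta> + t * cos \<theta>]) \<partial>lborel) =
      (\<integral>\<^sup>+ x. ennreal (1 / cos \<theta>) * g (vector [x, x * sin \<theta> / cos \<theta> + t / cos \<theta>]) \<partial>lborel)"
      using c by (simp add: nn_integral_cmult)
  qed
  also have "\<dots> = (\<integral>\<^sup>+ x. \<integral>\<^sup>+ t. ennreal (1 / cos \<theta>) * g (vector [x, x * sin \<theta> / cos \<theta> + t / cos \<theta>]) \<partial>lborel \<partial>lborel)"
    by (rule lborel_pair.Fubini') simp
  also have "\<dots> = (\<integral>\<^sup>+ x. \<integral>\<^sup>+ y. g (vector [x, y]) \<partial>lborel \<partial>lborel)"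
  proof (rule nn_integral_cong)
    fix x :: real
    show "(\<integral>\<^sup>+ t. ennreal (1 / cos \<theta>) * g (vector [x, x * sin \<theta> / cos \<theta> + t / cos \<theta>]) \<partial>lborel) = (\<integral>\<^sup>+ y. g (vector [x, y]) \<partial>lborel)"
      using c by (subst nn_integral_real_affine[of "\<lambda>y. g (vector [x, y])" "1 / cos \<theta>" "x * sin \<theta> / cos \<theta>"])
        (auto simp: nn_integral_cmult)
  qed
  also have "\<dots> = emeasure lborel A"
    by (simp add: nn_integral_real_2[symmetric] g_def)
  finally show "emeasure (distr (lborel \<Otimes>\<^sub>M lborel) borel (\<lambda>(p, t). p *\<^sub>R circle_point \<theta> + t *\<^sub>R perp (circle_point \<theta>))) A = emeasure lborel A" .
qed simp

text \<open>In the rotated coordinates (p, t) the phase is p * \<sigma> and does not involve t, so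
  integrating over t first leaves the transform of the line integrals.\<close>

lemma fourier_slice:
  fixes f :: "real^2 \<Rightarrow> complex"
  assumes f: "integrable lborel f" and c: "cos \<theta> > 0"
  defines "g \<equiv> \<lambda>p. LINT t|lborel. f (p *\<^sub>R circle_point \<theta> + t *\<^sub>R perp (circle_point \<theta>))"
  shows "integrable lborel g" and "ft (-1) g \<sigma> = ft (-1) f (\<sigma> *\<^sub>R circle_point \<theta>)"
proof -
  define T where "T = (\<lambda>(p, t). p *\<^sub>R circle_point \<theta> + t *\<^sub>R perp (circle_point \<theta>))"
  have T: "T \<in> borel_measurable (lborel \<Otimes>\<^sub>M lborel)" "distr (lborel \<Otimes>\<^sub>M lborel) borel T = lborel"
    using distr_rotation[OF c] by (auto simp: T_def)
  note [measurable] = T(1)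
  have int: "integrable (lborel \<Otimes>\<^sub>M lborel) (\<lambda>x. h (T x))" if "integrable lborel h" for h :: "_ \<Rightarrow> complex"
    using that T(2) integrable_distr[OF T(1), of h] by simp
  show "integrable lborel g"
    using lborel_pair.integrable_fst'[OF int[OF f]] by (simp add: T_def g_def)
  have cis_f: "integrable lborel (\<lambda>x. cis (-1 * (x \<bullet> (\<sigma> *\<^sub>R circle_point \<theta>))) * f x)"
    using f by (rule integrable_cis_mult) auto
  have inner: "T (p, t) \<bullet> (\<sigma> *\<^sub>R circle_point \<theta>) = p * \<sigma>" for p t
  proof -
    have "T (p, t) \<bullet> (\<sigma> *\<^sub>R circle_point \<theta>) = p * \<sigma> * ((cos \<theta>)\<^sup>2 + (sin \<theta>)\<^sup>2)"
      by (simp add: T_def inner_real_2 algebra_simps power2_eq_square del: sin_cos_squared_add sin_cos_squared_add2 sin_cos_squared_add3)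
    then show ?thesis by simp
  qed
  have "ft (-1) f (\<sigma> *\<^sub>R circle_point \<theta>) = integral\<^sup>L (distr (lborel \<Otimes>\<^sub>M lborel) borel T) (\<lambda>x. cis (-1 * (x \<bullet> (\<sigma> *\<^sub>R circle_point \<theta>))) * f x)"
    unfolding ft_def T(2) ..
  also have "\<dots> = integral\<^sup>L (lborel \<Otimes>\<^sub>M lborel) (\<lambda>z. cis (-1 * (T z \<bullet> (\<sigma> *\<^sub>R circle_point \<theta>))) * f (T z))"
    using cis_f by (intro integral_distr T(1)) (auto dest: borel_measurable_integrable)
  also have "\<dots> = (LINT p|lborel. LINT t|lborel. cis (-1 * (T (p, t) \<bullet> (\<sigma> *\<^sub>R circle_point \<theta>))) * f (T (p, t)))"
    by (rule lborel_pair.integral_fst'[OF int[OF cis_f], symmetric])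
  also have "\<dots> = ft (-1) g \<sigma>"
    unfolding inner by (simp add: ft_def g_def T_def)
  finally show "ft (-1) g \<sigma> = ft (-1) f (\<sigma> *\<^sub>R circle_point \<theta>)" ..
qed

section \<open>Arclength and the norm of the Radon transform\<close>

lemma circle_arc_sets [measurable]: "circle_arc \<beta> \<in> sets borel"
proof -
  have "circle_arc \<beta> = circle_point ` {- \<beta>..\<beta>}" by (auto simp: circle_arc_def abs_le_iff)
  then have "compact (circle_arc \<beta>)"
    by (simp add: compact_continuous_image continuous_circle_point)
  then show ?thesis by (simp add: borel_compact)
qed

lemma measurable_circle_point_arclength:
  "circle_point \<in> restrict_space lborel {-pi<..pi} \<rightarrow>\<^sub>M restrict_space borel (sphere 0 1)"
  by (intro measurable_restrict_space2 measurable_restrict_space1) auto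

lemma finite_measure_arclength: "finite_measure arclength"
  unfolding arclength_def
proof (rule finite_measure.finite_measure_distr[OF _ measurable_circle_point_arclength])
  show "finite_measure (restrict_space lborel {-pi<..pi})"
    by (rule finite_measureI) (simp add: space_restrict_space emeasure_restrict_space)
qed

lemma nn_integral_arclength_ge:
  assumes [measurable]: "G \<in> borel_measurable (restrict_space borel (sphere 0 1))" and \<delta>: "\<delta> < pi"
  shows "(\<integral>\<^sup>+ \<theta>. G (circle_point \<theta>) * indicator {- \<delta>..\<delta>} \<theta> \<partial>lborel) \<le> (\<integral>\<^sup>+ v. G v \<partial>arclength)"
proof -
  have "(\<integral>\<^sup>+ v. G v \<partial>arclength) = (\<integral>\<^sup>+ \<theta>. G (circle_point \<theta>) * indicator {-pi<..pi} \<theta> \<partial>lborel)"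
    unfolding arclength_def
    by (subst nn_integral_distr[OF measurable_circle_point_arclength]) (auto simp: nn_integral_restrict_space)
  also have "\<dots> \<ge> (\<integral>\<^sup>+ \<theta>. G (circle_point \<theta>) * indicator {- \<delta>..\<delta>} \<theta> \<partial>lborel)"
    using \<delta> by (intro nn_integral_mono) (auto simp: indicator_def)
  finally show ?thesis .
qed

text \<open>The measure \<open>arclength\<close> lives on the trace sigma-algebra of the sphere.
  Measurability is shown over the whole plane of directions and pulled back along the
  inclusion.\<close>

lemma measurable_radon:
  assumes [measurable]: "f \<in> borel_measurable borel"
  shows "radon \<delta> f \<in> borel_measurable (lborel \<Otimes>\<^sub>M arclength)"
proof -
  have 1: "radon \<delta> f \<in> borel_measurable (borel \<Otimes>\<^sub>M borel)"
    unfolding radon_def by measurable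
  have 2: "(\<lambda>z. z) \<in> lborel \<Otimes>\<^sub>M arclength \<rightarrow>\<^sub>M borel \<Otimes>\<^sub>M (borel :: (real^2) measure)"
  proof -
    have "(\<lambda>v. v) \<in> arclength \<rightarrow>\<^sub>M borel"
      using measurable_restrict_space1[of "\<lambda>v. v" borel borel]
      by (subst measurable_cong_sets[of arclength "restrict_space borel (sphere 0 1)"]) (auto simp: arclength_def)
    then have "(\<lambda>z. (fst z, snd z)) \<in> lborel \<Otimes>\<^sub>M arclength \<rightarrow>\<^sub>M borel \<Otimes>\<^sub>M (borel :: (real^2) measure)"
      by (intro measurable_Pair measurable_compose[OF measurable_snd]) auto
    then show ?thesis by simp
  qed
  from measurable_compose[OF 2 1] show ?thesis .
qed

text \<open>For each direction in the arc, the slice theorem identifies the radial restriction of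
  the transform with a one-dimensional transform, and Bessel on the line gives the factor 2 *
  pi.\<close>

lemma sq_int_radon_ge:
  assumes f: "integrable lborel f" and \<delta>: "0 < \<delta>" "\<delta> < pi / 2"
  shows "(\<integral>\<^sup>+ \<theta>. (\<integral>\<^sup>+ \<sigma>. ennreal ((cmod (ft (-1) f (\<sigma> *\<^sub>R circle_point \<theta>)))\<^sup>2) \<partial>lborel) * indicator {- \<delta>..\<delta>} \<theta> \<partial>lborel)
     \<le> ennreal (2 * pi) * sq_int (lborel \<Otimes>\<^sub>M arclength) (radon \<delta> f)"
proof -
  have [measurable]: "f \<in> borel_measurable borel" using f by auto
  interpret A: finite_measure arclength by (rule finite_measure_arclength)
  interpret P: pair_sigma_finite lborel arclength ..
  note R [measurable] = measurable_radon[of f \<delta>]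
  define G where "G v = (\<integral>\<^sup>+ p. ennreal ((cmod (radon \<delta> f (p, v)))\<^sup>2) \<partial>lborel)" for v
  have G: "G \<in> borel_measurable arclength"
    unfolding G_def by measurable
  then have G': "G \<in> borel_measurable (restrict_space borel (sphere 0 1))"
    by (simp add: arclength_def cong: measurable_cong_sets)
  have "(\<integral>\<^sup>+ \<theta>. (\<integral>\<^sup>+ \<sigma>. ennreal ((cmod (ft (-1) f (\<sigma> *\<^sub>R circle_point \<theta>)))\<^sup>2) \<partial>lborel) * indicator {- \<delta>..\<delta>} \<theta> \<partial>lborel)
     \<le> (\<integral>\<^sup>+ \<theta>. ennreal (2 * pi) * (G (circle_point \<theta>) * indicator {- \<delta>..\<delta>} \<theta>) \<partial>lborel)"
  proof (rule nn_integral_mono)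
    fix \<theta>
    show "(\<integral>\<^sup>+ \<sigma>. ennreal ((cmod (ft (-1) f (\<sigma> *\<^sub>R circle_point \<theta>)))\<^sup>2) \<partial>lborel) * indicator {- \<delta>..\<delta>} \<theta>
      \<le> ennreal (2 * pi) * (G (circle_point \<theta>) * indicator {- \<delta>..\<delta>} \<theta>)"
    proof (cases "\<theta> \<in> {- \<delta>..\<delta>}")
      case True
      then have c: "cos \<theta> > 0" using \<delta> by (intro cos_gt_zero_pi) auto
      define g where "g = (\<lambda>p. LINT t|lborel. f (p *\<^sub>R circle_point \<theta> + t *\<^sub>R perp (circle_point \<theta>)))"
      \<comment> \<open>On the arc the characteristic function is 1, so \<open>radon\<close> is the
        plain line integral.\<close>
      have "circle_point \<theta> \<in> circle_arc \<delta>"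
        using True by (auto simp: circle_arc_def abs_le_iff)
      then have "G (circle_point \<theta>) = sq_int lborel g"
        by (simp add: G_def radon_def g_def)
      moreover have "sq_int lborel (ft (-1) g) \<le> ennreal ((2 * pi) ^ DIM(real)) * sq_int lborel g"
        using fourier_slice(1)[OF f c] unfolding g_def by (intro sq_int_ft_le) auto
      ultimately show ?thesis
        using True fourier_slice(2)[OF f c, folded g_def] by simp
    qed simp
  qed
  also have "\<dots> = ennreal (2 * pi) * (\<integral>\<^sup>+ \<theta>. G (circle_point \<theta>) * indicator {- \<delta>..\<delta>} \<theta> \<partial>lborel)"
  proof (rule nn_integral_cmult)
    have "(\<lambda>\<theta>. G (circle_point \<theta>)) \<in> borel_measurable borel"
    proof (rule measurable_compose[OF _ G'])
      show "circle_point \<in> borel \<rightarrow>\<^sub>M restrict_space borel (sphere 0 1)"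
        by (intro measurable_restrict_space2) auto
    qed
    then show "(\<lambda>\<theta>. G (circle_point \<theta>) * indicator {- \<delta>..\<delta>} \<theta>) \<in> borel_measurable lborel" by simp
  qed
  also have "\<dots> \<le> ennreal (2 * pi) * (\<integral>\<^sup>+ v. G v \<partial>arclength)"
    using \<delta> pi_gt_zero by (intro mult_left_mono nn_integral_arclength_ge G') auto
  also have "(\<integral>\<^sup>+ v. G v \<partial>arclength) = sq_int (lborel \<Otimes>\<^sub>M arclength) (radon \<delta> f)"
    unfolding G_def using P.nn_integral_snd[of "\<lambda>z. ennreal ((cmod (radon \<delta> f z))\<^sup>2)"] by simp
  finally show ?thesis .
qed

text \<open>The angle is the arctangent of the slope. In these coordinates measurability, the
  vertical sections and the dependence on \<open>\<beta>\<close> of the cone can be read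
  off.\<close>

lemma angle_cone_iff:
  assumes \<beta>: "0 < \<beta>" "\<beta> < pi / 2"
  shows "\<xi> \<in> angle_cone \<beta> \<longleftrightarrow> \<xi> $ 1 > 0 \<and> \<bar>\<xi> $ 2\<bar> \<le> \<xi> $ 1 * tan \<beta>"
proof
  assume "\<xi> \<in> angle_cone \<beta>"
  then obtain \<theta> where \<xi>: "\<xi> \<noteq> 0" and \<theta>: "\<xi> /\<^sub>R norm \<xi> = circle_point \<theta>" "\<bar>\<theta>\<bar> \<le> \<beta>"
    by (auto simp: angle_cone_def circle_arc_def)
  have "\<xi> = norm \<xi> *\<^sub>R circle_point \<theta>" using \<xi> by (simp flip: \<theta>(1))
  then have eq: "\<xi> $ 1 = norm \<xi> * cos \<theta>" "\<xi> $ 2 = norm \<xi> * sin \<theta>"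
    by (metis circle_point_nth vector_scaleR_component real_scaleR_def)+
  have c: "cos \<theta> > 0" using \<theta>(2) \<beta> by (intro cos_gt_zero_pi) auto
  have "tan \<bar>\<theta>\<bar> \<le> tan \<beta>" using \<theta>(2) \<beta> by (intro tan_mono_le) auto
  moreover have "tan \<bar>\<theta>\<bar> = \<bar>sin \<theta>\<bar> / cos \<theta>"
  proof -
    have "0 \<le> sin \<bar>\<theta>\<bar>" using \<theta>(2) \<beta> by (intro sin_ge_zero) auto
    then have "sin \<bar>\<theta>\<bar> = \<bar>sin \<theta>\<bar>" by (auto simp: abs_if split: if_splits)
    then show ?thesis by (simp add: tan_def)
  qed
  ultimately have "\<bar>sin \<theta>\<bar> \<le> cos \<theta> * tan \<beta>" using c by (simp add: field_simps)
  then have "norm \<xi> * \<bar>sin \<theta>\<bar> \<le> norm \<xi> * (cos \<theta> * tan \<beta>)" by (intro mult_left_mono) auto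
  then show "\<xi> $ 1 > 0 \<and> \<bar>\<xi> $ 2\<bar> \<le> \<xi> $ 1 * tan \<beta>"
    using \<xi> c unfolding eq by (simp add: abs_mult mult.assoc)
next
  assume \<xi>: "\<xi> $ 1 > 0 \<and> \<bar>\<xi> $ 2\<bar> \<le> \<xi> $ 1 * tan \<beta>"
  define u where "u = \<xi> $ 2 / \<xi> $ 1"
  have "\<bar>u\<bar> \<le> tan \<beta>" using \<xi> by (simp add: u_def abs_div field_simps)
  then have "arctan u \<le> arctan (tan \<beta>)" "arctan (- u) \<le> arctan (tan \<beta>)"
    unfolding arctan_le_iff by auto
  then have "\<bar>arctan u\<bar> \<le> \<beta>" using \<beta> by (simp add: arctan_tan arctan_minus)
  moreover have "\<xi> /\<^sub>R norm \<xi> = circle_point (arctan u)"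
  proof -
    have "(\<xi> $ 1)\<^sup>2 + (\<xi> $ 2)\<^sup>2 = (\<xi> $ 1)\<^sup>2 * (1 + u\<^sup>2)"
      using \<xi> by (simp add: u_def power_divide field_simps)
    then have n: "norm \<xi> = \<xi> $ 1 * sqrt (1 + u\<^sup>2)"
      using \<xi> by (simp add: norm_real_2 real_sqrt_mult)
    have "1 + u\<^sup>2 > 0" by (simp add: add_pos_nonneg)
    with \<xi> show ?thesis
      by (simp add: vec_eq_iff forall_2 n cos_arctan sin_arctan) (simp add: u_def field_simps)
  qed
  moreover have "\<xi> \<noteq> 0" using \<xi> by auto
  ultimately show "\<xi> \<in> angle_cone \<beta>"
    by (auto simp: angle_cone_def circle_arc_def)
qed

lemma angle_cone_sets [measurable]:
  assumes "0 < \<beta>" "\<beta> < pi / 2" shows "angle_cone \<beta> \<in> sets borel"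
proof -
  have "angle_cone \<beta> = {\<xi> \<in> space borel. \<xi> $ 1 > 0 \<and> \<bar>\<xi> $ 2\<bar> \<le> \<xi> $ 1 * tan \<beta>}"
    using angle_cone_iff[OF assms] by auto
  also have "\<dots> \<in> sets borel" by measurable
  finally show ?thesis .
qed

text \<open>Polar coordinates reduce to one dimension: substitute \<open>x = \<sigma> cos \<theta>\<close> for fixed \<open>\<theta>\<close>, exchange the
  integrals, and substitute \<open>y = x tan \<theta>\<close> for fixed \<open>x\<close>.\<close>

lemma nn_integral_angle_cone_polar:
  fixes G :: "real^2 \<Rightarrow> ennreal"
  assumes [measurable]: "G \<in> borel_measurable borel" and \<delta>: "0 < \<delta>" "\<delta> < pi / 2"
  shows "(\<integral>\<^sup>+ \<theta>. (\<integral>\<^sup>+ \<sigma>. G (\<sigma> *\<^sub>R circle_point \<theta>) * indicator {0<..} \<sigma> \<partial>lborel) * indicator {- \<delta>..\<delta>} \<theta> \<partial>lborel) =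
     (\<integral>\<^sup>+ \<xi>. G \<xi> * ennreal (1 / norm \<xi>) * indicator (angle_cone \<delta>) \<xi> \<partial>lborel)"
proof -
  have c: "cos \<theta> > 0" if "\<theta> \<in> {- \<delta>..\<delta>}" for \<theta>
    using that \<delta> by (intro cos_gt_zero_pi) auto
  have "(\<integral>\<^sup>+ \<theta>. (\<integral>\<^sup>+ \<sigma>. G (\<sigma> *\<^sub>R circle_point \<theta>) * indicator {0<..} \<sigma> \<partial>lborel) * indicator {- \<delta>..\<delta>} \<theta> \<partial>lborel) =
    (\<integral>\<^sup>+ \<theta>. (\<integral>\<^sup>+ x. G (vector [x, x * tan \<theta>]) * ennreal (1 / cos \<theta>) * indicator {0<..} x * indicator {- \<delta>..\<delta>} \<theta> \<partial>lborel) \<partial>lborel)"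
  proof (rule nn_integral_cong)
    fix \<theta>
    show "(\<integral>\<^sup>+ \<sigma>. G (\<sigma> *\<^sub>R circle_point \<theta>) * indicator {0<..} \<sigma> \<partial>lborel) * indicator {- \<delta>..\<delta>} \<theta> =
      (\<integral>\<^sup>+ x. G (vector [x, x * tan \<theta>]) * ennreal (1 / cos \<theta>) * indicator {0<..} x * indicator {- \<delta>..\<delta>} \<theta> \<partial>lborel)"
    proof (cases "\<theta> \<in> {- \<delta>..\<delta>}")
      case True
      note c = c[OF True]
      have "(\<integral>\<^sup>+ \<sigma>. G (\<sigma> *\<^sub>R circle_point \<theta>) * indicator {0<..} \<sigma> \<partial>lborel) =
         ennreal \<bar>1 / cos \<theta>\<bar> * (\<integral>\<^sup>+ x. G ((0 + 1 / cos \<theta> * x) *\<^sub>R circle_point \<theta>) * indicator {0<..} (0 + 1 / cos \<theta> * x) \<partial>lborel)"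
        using c by (intro nn_integral_real_affine) auto
      also have "\<dots> = (\<integral>\<^sup>+ x. ennreal \<bar>1 / cos \<theta>\<bar> * (G ((0 + 1 / cos \<theta> * x) *\<^sub>R circle_point \<theta>) * indicator {0<..} (0 + 1 / cos \<theta> * x)) \<partial>lborel)"
        by (simp add: nn_integral_cmult)
      also have "\<dots> = (\<integral>\<^sup>+ x. G (vector [x, x * tan \<theta>]) * ennreal (1 / cos \<theta>) * indicator {0<..} x * indicator {- \<delta>..\<delta>} \<theta> \<partial>lborel)"
        using c True by (intro nn_integral_cong)
          (auto simp: scaleR_circle_point tan_def mult_ac indicator_def zero_less_divide_iff)
      finally show ?thesis using True by simp
    qed simp
  qed
  also have "\<dots> = (\<integral>\<^sup>+ x. (\<integral>\<^sup>+ \<theta>. G (vector [x, x * tan \<theta>]) * ennreal (1 / cos \<theta>) * indicator {0<..} x * indicator {- \<delta>..\<delta>} \<theta> \<partial>lborel) \<partial>lborel)"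
    unfolding tan_def by (rule lborel_pair.Fubini') simp
  also have "\<dots> = (\<integral>\<^sup>+ x. \<integral>\<^sup>+ y. G (vector [x, y]) * ennreal (1 / norm (vector [x, y] :: real^2)) * indicator (angle_cone \<delta>) (vector [x, y]) \<partial>lborel \<partial>lborel)"
  proof (rule nn_integral_cong)
    fix x :: real
    show "(\<integral>\<^sup>+ \<theta>. G (vector [x, x * tan \<theta>]) * ennreal (1 / cos \<theta>) * indicator {0<..} x * indicator {- \<delta>..\<delta>} \<theta> \<partial>lborel) =
      (\<integral>\<^sup>+ y. G (vector [x, y]) * ennreal (1 / norm (vector [x, y] :: real^2)) * indicator (angle_cone \<delta>) (vector [x, y]) \<partial>lborel)"
    proof (cases "x > 0")
      case True
      have "(\<integral>\<^sup>+ y. G (vector [x, y]) * ennreal (1 / norm (vector [x, y] :: real^2)) * indicator (angle_cone \<delta>) (vector [x, y]) \<partial>lborel) =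
        (\<integral>\<^sup>+ y. G (vector [x, y]) * ennreal (1 / norm (vector [x, y] :: real^2)) * indicator {x * tan (- \<delta>)..x * tan \<delta>} y \<partial>lborel)"
        using True by (intro nn_integral_cong) (auto simp: indicator_def angle_cone_iff[OF \<delta>])
      also have "\<dots> = (\<integral>\<^sup>+ \<theta>. G (vector [x, x * tan \<theta>]) * ennreal (1 / norm (vector [x, x * tan \<theta>] :: real^2)) * ennreal (x / (cos \<theta>)\<^sup>2) * indicator {- \<delta>..\<delta>} \<theta> \<partial>lborel)"
      proof (rule nn_integral_substitution_aux)
        show "((\<lambda>\<theta>. x * tan \<theta>) has_real_derivative x / (cos \<theta>)\<^sup>2) (at \<theta>)" if "\<theta> \<in> {- \<delta>..\<delta>}" for \<theta>
          using c[OF that] by (auto intro!: derivative_eq_intros simp: field_simps)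
        show "continuous_on {- \<delta>..\<delta>} (\<lambda>\<theta>. x / (cos \<theta>)\<^sup>2)"
          using c by (intro continuous_intros) force
      qed (use True \<delta> in auto)
      also have "\<dots> = (\<integral>\<^sup>+ \<theta>. G (vector [x, x * tan \<theta>]) * ennreal (1 / cos \<theta>) * indicator {0<..} x * indicator {- \<delta>..\<delta>} \<theta> \<partial>lborel)"
      proof (rule nn_integral_cong)
        fix \<theta>
        show "G (vector [x, x * tan \<theta>]) * ennreal (1 / norm (vector [x, x * tan \<theta>] :: real^2)) * ennreal (x / (cos \<theta>)\<^sup>2) * indicator {- \<delta>..\<delta>} \<theta> =
          G (vector [x, x * tan \<theta>]) * ennreal (1 / cos \<theta>) * indicator {0<..} x * indicator {- \<delta>..\<delta>} \<theta>"
        proof (cases "\<theta> \<in> {- \<delta>..\<delta>}")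
          case in\<delta>: True
          note c = c[OF in\<delta>]
          \<comment> \<open>The point has polar radius x / cos \<theta>, so the weight 1 / norm
            times the Jacobian x / cos^2 \<theta> leaves exactly the 1 / cos \<theta> of the radial
            substitution.\<close>
          have "vector [x, x * tan \<theta>] = (x / cos \<theta>) *\<^sub>R circle_point \<theta>"
            using c by (simp add: scaleR_circle_point tan_def)
          then have "norm (vector [x, x * tan \<theta>] :: real^2) = x / cos \<theta>"
            using c True by simp
          then have "ennreal (1 / norm (vector [x, x * tan \<theta>] :: real^2)) * ennreal (x / (cos \<theta>)\<^sup>2) = ennreal (1 / cos \<theta>)"
            using c True by (subst ennreal_mult[symmetric]) (auto simp: field_simps power2_eq_square)
          then show ?thesis using True in\<delta> by (simp add: mult.assoc)
        qed simp
      qed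
      finally show ?thesis ..
    next
      case False
      then show ?thesis by (simp add: indicator_def angle_cone_iff[OF \<delta>])
    qed
  qed
  also have "\<dots> = (\<integral>\<^sup>+ \<xi>. G \<xi> * ennreal (1 / norm \<xi>) * indicator (angle_cone \<delta>) \<xi> \<partial>lborel)"
    using angle_cone_sets[OF \<delta>] by (subst nn_integral_real_2) auto
  finally show ?thesis .
qed

section \<open>Norms of cone multipliers\<close>

lemma ennreal_sqrt_less_iff:
  assumes e: "e > 0" shows "ennreal_sqrt a < ennreal e \<longleftrightarrow> a < ennreal (e\<^sup>2)"
proof (cases a)
  case (real x)
  have "sqrt x < e \<longleftrightarrow> x < e\<^sup>2"
    using real_sqrt_less_iff[of x "e\<^sup>2"] e by simp
  with real show ?thesis by (simp add: ennreal_sqrt_def ennreal_less_iff)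
qed (simp add: ennreal_sqrt_def)

lemma ennreal_tendsto_0_iff:
  fixes f :: "'a \<Rightarrow> ennreal"
  shows "(f \<longlongrightarrow> 0) F \<longleftrightarrow> (\<forall>e>0. eventually (\<lambda>x. f x < ennreal e) F)"
proof
  assume *: "\<forall>e>0. eventually (\<lambda>x. f x < ennreal e) F"
  show "(f \<longlongrightarrow> 0) F"
  proof (rule order_tendstoI)
    fix a :: ennreal assume a: "0 < a"
    obtain e where e: "e > 0" "ennreal e \<le> a"
    proof (cases a)
      case (real r) with a that[of r] show ?thesis by auto
    next
      case top with that[of 1] show ?thesis by auto
    qed
    from *[rule_format, OF e(1)] show "eventually (\<lambda>x. f x < a) F"
      by eventually_elim (use e(2) in auto)
  qed auto
qed (auto intro: order_tendstoD)

lemma L2_norm_tendsto_0_iff: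
  "((\<lambda>r. L2_norm M (u r)) \<longlongrightarrow> 0) F \<longleftrightarrow> ((\<lambda>r. sq_int M (u r)) \<longlongrightarrow> 0) F"
proof -
  have "(\<forall>e>0. eventually (\<lambda>r. sq_int M (u r) < ennreal (e\<^sup>2)) F) \<longleftrightarrow>
      (\<forall>e>0. eventually (\<lambda>r. sq_int M (u r) < ennreal e) F)"
  proof safe
    fix e :: real assume "\<forall>e>0. eventually (\<lambda>r. sq_int M (u r) < ennreal (e\<^sup>2)) F" "e > 0"
    from this(1)[rule_format, of "sqrt e"] this(2) show "eventually (\<lambda>r. sq_int M (u r) < ennreal e) F"
      by simp
  qed auto
  then show ?thesis
    unfolding ennreal_tendsto_0_iff L2_norm_def by (simp add: ennreal_sqrt_less_iff)
qed

lemma ennreal_sqrt_le_twice: "a \<le> 4 * b \<Longrightarrow> ennreal_sqrt a \<le> 2 * ennreal_sqrt b"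
proof (cases b)
  case (real r)
  assume "a \<le> 4 * b"
  then have le: "a \<le> ennreal (4 * r)" using real by (simp add: ennreal_mult)
  then obtain s where s: "a = ennreal s" "0 \<le> s" by (cases a) (auto simp: top_unique)
  then have "s \<le> 4 * r" using le real by simp
  then have "sqrt s \<le> sqrt (2\<^sup>2 * r)" by simp
  also have "\<dots> = 2 * sqrt r" by (subst real_sqrt_mult) simp
  finally have "ennreal (sqrt s) \<le> ennreal (2 * sqrt r)" by (rule ennreal_leI)
  then show ?thesis using s real by (simp add: ennreal_sqrt_def ennreal_mult)
qed (auto simp: ennreal_sqrt_def ennreal_mult_top)

lemma le_of_ennreal_sqrt_le:
  assumes "ennreal_sqrt a \<le> ennreal N * ennreal_sqrt b" "0 \<le> N" "b \<noteq> \<infinity>"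
  shows "a \<le> ennreal (N\<^sup>2) * b"
proof -
  obtain r where r: "b = ennreal r" "0 \<le> r" using assms(3) by (cases b) auto
  have le: "ennreal_sqrt a \<le> ennreal (N * sqrt r)"
    using assms(1,2) r by (simp add: ennreal_sqrt_def ennreal_mult)
  then obtain s where s: "a = ennreal s" "0 \<le> s"
    by (cases a) (auto simp: ennreal_sqrt_def top_unique)
  have "sqrt s \<le> N * sqrt r" using le s r assms(2) by (simp add: ennreal_sqrt_def)
  then have "(sqrt s)\<^sup>2 \<le> (N * sqrt r)\<^sup>2" using s by (intro power_mono) auto
  then have "s \<le> N\<^sup>2 * r" using s r by (simp add: power_mult_distrib)
  then have "ennreal s \<le> ennreal (N\<^sup>2 * r)" by (rule ennreal_leI)
  then show ?thesis using s r by (simp add: ennreal_mult)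
qed

section \<open>The transforms chosen by \<open>SOME\<close>, made concrete\<close>

lemma fourier_ball_eq: "fourier_ball r f = ft (-1) (cut r f)"
  by (rule ext) (simp add: fourier_ball_def ft_def cut_def set_lebesgue_integral_def cis_conv_exp)

lemma inv_fourier_ball_eq: "inv_fourier_ball r F x = ft 1 (cut r F) x / complex_of_real ((2 * pi)\<^sup>2)"
  by (simp add: inv_fourier_ball_def ft_def cut_def set_lebesgue_integral_def cis_conv_exp inner_commute)

text \<open>Existence of the limit turns the choice in \<open>fourier\<close> into a genuine
  representative.\<close>

lemma fourier_L2:
  assumes "f \<in> L2 lborel"
  shows "fourier f \<in> L2 lborel"
    and "((\<lambda>r. sq_int lborel (\<lambda>\<xi>. ft (-1) (cut r f) \<xi> - fourier f \<xi>)) \<longlongrightarrow> 0) at_top"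
proof -
  have "\<exists>g. g \<in> L2 lborel \<and> ((\<lambda>r. L2_norm lborel (\<lambda>\<xi>. fourier_ball r f \<xi> - g \<xi>)) \<longlongrightarrow> 0) at_top"
    using ft_cut_limit_exists[OF assms, of "-1"] by (auto simp: L2_norm_tendsto_0_iff fourier_ball_eq)
  from someI_ex[OF this, folded fourier_def]
  show "fourier f \<in> L2 lborel"
    and "((\<lambda>r. sq_int lborel (\<lambda>\<xi>. ft (-1) (cut r f) \<xi> - fourier f \<xi>)) \<longlongrightarrow> 0) at_top"
    by (auto simp: L2_norm_tendsto_0_iff fourier_ball_eq)
qed

lemma sq_int_divide:
  assumes "f \<in> borel_measurable M"
  shows "sq_int M (\<lambda>x. f x / c) = ennreal (1 / (cmod c)\<^sup>2) * sq_int M f"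
  using assms by (subst nn_integral_cmult[symmetric])
    (auto simp: norm_divide power_divide ennreal_mult[symmetric] intro!: nn_integral_cong)

lemma inv_fourier_L2:
  assumes F: "F \<in> L2 lborel"
  shows "inv_fourier F \<in> L2 lborel"
    and "((\<lambda>r. sq_int lborel (\<lambda>x. ft 1 (cut r F) x / complex_of_real ((2 * pi)\<^sup>2) - inv_fourier F x)) \<longlongrightarrow> 0) at_top"
proof -
  define c where "c = complex_of_real ((2 * pi)\<^sup>2)"
  obtain g where g: "g \<in> L2 lborel" and lim: "((\<lambda>r. sq_int lborel (\<lambda>x. ft 1 (cut r F) x - g x)) \<longlongrightarrow> 0) at_top"
    using ft_cut_limit_exists[OF F, of 1] by auto
  have [measurable]: "g \<in> borel_measurable borel" "cut r F \<in> borel_measurable borel" for r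
    using g cut_L2[OF F] by (auto simp: L2_iff)
  have "(\<lambda>x. g x / c) \<in> L2 lborel"
    using g unfolding L2_iff by (auto simp: sq_int_divide ennreal_mult_less_top)
  moreover have "((\<lambda>r. sq_int lborel (\<lambda>x. ft 1 (cut r F) x / c - g x / c)) \<longlongrightarrow> 0) at_top"
  proof -
    have "((\<lambda>r. ennreal (1 / (cmod c)\<^sup>2) * sq_int lborel (\<lambda>x. ft 1 (cut r F) x - g x)) \<longlongrightarrow> ennreal (1 / (cmod c)\<^sup>2) * 0) at_top"
      by (intro ennreal_tendsto_cmult lim) simp
    moreover have "sq_int lborel (\<lambda>x. ft 1 (cut r F) x / c - g x / c) =
        ennreal (1 / (cmod c)\<^sup>2) * sq_int lborel (\<lambda>x. ft 1 (cut r F) x - g x)" for r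
      by (subst sq_int_divide[symmetric]) (auto simp: diff_divide_distrib)
    ultimately show ?thesis by simp
  qed
  ultimately have "\<exists>g. g \<in> L2 lborel \<and> ((\<lambda>r. L2_norm lborel (\<lambda>x. inv_fourier_ball r F x - g x)) \<longlongrightarrow> 0) at_top"
    unfolding L2_norm_tendsto_0_iff inv_fourier_ball_eq c_def[symmetric] by blast
  from someI_ex[OF this, folded inv_fourier_def]
  show "inv_fourier F \<in> L2 lborel"
    and "((\<lambda>r. sq_int lborel (\<lambda>x. ft 1 (cut r F) x / complex_of_real ((2 * pi)\<^sup>2) - inv_fourier F x)) \<longlongrightarrow> 0) at_top"
    unfolding L2_norm_tendsto_0_iff inv_fourier_ball_eq by blast+
qed

lemma fourier_inv_fourier: "F \<in> L2 lborel \<Longrightarrow> AE \<xi> in lborel. fourier (inv_fourier F) \<xi> = F \<xi>"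
  using fourier_inversion_L2[OF _ inv_fourier_L2(1) fourier_L2(1)[OF inv_fourier_L2(1)] _ fourier_L2(2)[OF inv_fourier_L2(1)]]
    inv_fourier_L2(2) by simp

text \<open>Truncation at radius 1 or more leaves such an f unchanged, so the family defining
  \<open>fourier f\<close> is eventually constant and its limit is the Fourier integral almost
  everywhere.\<close>

lemma L2_unit_ballD:
  assumes f: "f \<in> L2_unit_ball"
  shows "f \<in> L2 lborel" "integrable lborel f" "AE \<xi> in lborel. fourier f \<xi> = ft (-1) f \<xi>"
proof -
  show L2: "f \<in> L2 lborel" using f by (simp add: L2_unit_ball_def)
  have cut: "cut r f = f" if "r \<ge> 1" for r
    using f that by (auto simp: cut_def L2_unit_ball_def indicator_def fun_eq_iff)
  show int: "integrable lborel f"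
    using integrable_cut[OF L2, of 1] by (simp add: cut)
  have [measurable]: "f \<in> borel_measurable borel" "fourier f \<in> borel_measurable borel"
    using L2 fourier_L2(1)[OF L2] by (auto simp: L2_iff)
  have "eventually (\<lambda>r. sq_int lborel (\<lambda>\<xi>. ft (-1) (cut r f) \<xi> - fourier f \<xi>) =
      sq_int lborel (\<lambda>\<xi>. ft (-1) f \<xi> - fourier f \<xi>)) at_top"
    using eventually_ge_at_top[of 1] by eventually_elim (simp add: cut)
  then have "((\<lambda>r::real. sq_int lborel (\<lambda>\<xi>. ft (-1) f \<xi> - fourier f \<xi>)) \<longlongrightarrow> 0) at_top"
    using fourier_L2(2)[OF L2] by (rule Lim_transform_eventually[rotated])
  then have "sq_int lborel (\<lambda>\<xi>. ft (-1) f \<xi> - fourier f \<xi>) = 0"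
    by (simp add: tendsto_const_iff)
  then have "AE \<xi> in lborel. ennreal ((cmod (ft (-1) f \<xi> - fourier f \<xi>))\<^sup>2) = 0"
    by (subst (asm) nn_integral_0_iff_AE) auto
  then show "AE \<xi> in lborel. fourier f \<xi> = ft (-1) f \<xi>"
    by eventually_elim (simp add: ennreal_eq_0_iff)
qed

text \<open>The cut-off transform is again in L2, so inversion shows it to be the transform of the
  multiplier almost everywhere, and the weighted integral ignores null sets. From here on only
  absolutely convergent Fourier integrals of f occur.\<close>

lemma sobolev_norm_cone_multiplier:
  assumes f: "f \<in> L2_unit_ball" and \<beta>: "0 < \<beta>" "\<beta> < pi / 2"
  shows "sobolev_norm s (cone_multiplier \<beta> f) = ennreal_sqrt (ennreal (1 / (2 * pi)\<^sup>2) *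
     (\<integral>\<^sup>+ \<xi>. ennreal ((1 + (norm \<xi>)\<^sup>2) powr s * (cmod (ft (-1) f \<xi>))\<^sup>2) * indicator (angle_cone \<beta>) \<xi> \<partial>lborel))"
proof -
  define F where "F = (\<lambda>\<xi>. indicator (angle_cone \<beta>) \<xi> * fourier f \<xi>)"
  note K = angle_cone_sets[OF \<beta>]
  have "fourier f \<in> L2 lborel" by (intro fourier_L2 L2_unit_ballD f)
  moreover have "sq_int lborel F \<le> sq_int lborel (fourier f)"
    by (intro nn_integral_mono) (auto simp: F_def indicator_def)
  ultimately have "F \<in> L2 lborel"
    using K unfolding L2_iff F_def by (auto intro: le_less_trans)
  then have "AE \<xi> in lborel. fourier (cone_multiplier \<beta> f) \<xi> = F \<xi>"
    unfolding cone_multiplier_def F_def[symmetric] by (rule fourier_inv_fourier)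
  then have "(\<integral>\<^sup>+ \<xi>. ennreal ((1 + (norm \<xi>)\<^sup>2) powr s * (cmod (fourier (cone_multiplier \<beta> f) \<xi>))\<^sup>2) \<partial>lborel) =
    (\<integral>\<^sup>+ \<xi>. ennreal ((1 + (norm \<xi>)\<^sup>2) powr s * (cmod (ft (-1) f \<xi>))\<^sup>2) * indicator (angle_cone \<beta>) \<xi> \<partial>lborel)"
    using L2_unit_ballD(3)[OF f] by (intro nn_integral_cong_AE, eventually_elim) (auto simp: F_def indicator_def)
  then show ?thesis by (simp add: sobolev_norm_def)
qed

text \<open>Cauchy-Schwarz against the indicator of the unit ball: this is where the support of f
  controls low frequencies pointwise.\<close>

lemma cmod_ft_sq_le:
  assumes f: "f \<in> L2_unit_ball"
  shows "ennreal ((cmod (ft s f \<xi>))\<^sup>2) \<le> emeasure lborel (ball (0 :: real^2) 1) * sq_int lborel f"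
proof -
  note int = L2_unit_ballD(2)[OF f]
  have [measurable]: "f \<in> borel_measurable borel" using int by auto
  have "ennreal (cmod (ft s f \<xi>)) \<le> (\<integral>\<^sup>+ x. ennreal (cmod (f x)) \<partial>lborel)"
    using ennreal_leI[OF norm_ft_le[of s f \<xi>]] int by (simp add: nn_integral_eq_integral)
  also have "\<dots> = (\<integral>\<^sup>+ x. indicator (ball 0 1) x * ennreal (cmod (f x)) \<partial>lborel)"
    using f by (intro nn_integral_cong) (auto simp: L2_unit_ball_def indicator_def)
  finally have "(ennreal (cmod (ft s f \<xi>)))\<^sup>2 \<le> (\<integral>\<^sup>+ x. indicator (ball 0 1) x * ennreal (cmod (f x)) \<partial>lborel)\<^sup>2"
    by (rule power_mono) simp
  also have "\<dots> \<le> (\<integral>\<^sup>+ x. (indicator (ball (0 :: real^2) 1) x)\<^sup>2 \<partial>lborel) * (\<integral>\<^sup>+ x. (ennreal (cmod (f x)))\<^sup>2 \<partial>lborel)"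
    by (rule Cauchy_Schwarz_nn_integral) (auto intro!: borel_measurable_indicator)
  also have "(\<integral>\<^sup>+ x. (indicator (ball (0 :: real^2) 1) x)\<^sup>2 \<partial>lborel) = emeasure lborel (ball (0 :: real^2) 1)"
  proof -
    have "(\<integral>\<^sup>+ x. (indicator (ball (0 :: real^2) 1) x)\<^sup>2 \<partial>lborel) = (\<integral>\<^sup>+ x. indicator (ball (0 :: real^2) 1) x \<partial>lborel)"
      by (intro nn_integral_cong) (simp split: split_indicator)
    then show ?thesis by simp
  qed
  finally show ?thesis by (simp add: ennreal_power)
qed

section \<open>Thin sectors\<close>

lemma circle_arc_mono: "\<beta> \<le> \<beta>' \<Longrightarrow> circle_arc \<beta> \<subseteq> circle_arc \<beta>'"
  unfolding circle_arc_def by force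

lemma angle_cone_mono: "\<beta> \<le> \<beta>' \<Longrightarrow> angle_cone \<beta> \<subseteq> angle_cone \<beta>'"
  using circle_arc_mono[of \<beta> \<beta>'] by (auto simp: angle_cone_def)

text \<open>Continuity of the measure from above replaces an area formula. The sectors shrink to the
  empty set because the tangent is continuous at \<open>\<delta>\<close> and the cone contains its
  edges; intersecting with the ball makes the measures finite.\<close>

lemma angle_cone_increment_small:
  assumes \<delta>: "0 < \<delta>" "\<delta> < pi / 2" and \<eta>: "\<eta> > 0"
  shows "\<exists>\<epsilon>>0. \<delta> + \<epsilon> < pi / 2 \<and>
     emeasure lborel ((angle_cone (\<delta> + \<epsilon>) - angle_cone \<delta>) \<inter> ball 0 M) \<le> ennreal \<eta>"
proof -
  \<comment> \<open>The factor 1 / 2 keeps even the largest opening, at n = 0, strictly below pi /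
    2.\<close>
  define e where "e n = (pi / 2 - \<delta>) / 2 * inverse (real (Suc n))" for n
  have e_pos: "e n > 0" for n using \<delta> by (simp add: e_def)
  have e_dec: "e n \<le> e m" if "m \<le> n" for m n
    using that \<delta> unfolding e_def by (intro mult_left_mono le_imp_inverse_le) auto
  have e_less: "\<delta> + e n < pi / 2" for n
  proof -
    have "e 0 = (pi / 2 - \<delta>) / 2" by (simp add: e_def)
    with e_dec[of 0 n] \<delta> show ?thesis by simp
  qed
  have e_lim: "(\<lambda>n. \<delta> + e n) \<longlonglongrightarrow> \<delta>"
    unfolding e_def by (rule tendsto_eq_intros LIMSEQ_inverse_real_of_nat refl | simp)+
  define W where "W n = (angle_cone (\<delta> + e n) - angle_cone \<delta>) \<inter> ball 0 M" for n
  have W_sets: "W n \<in> sets lborel" for n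
    using angle_cone_sets[of "\<delta> + e n"] angle_cone_sets[OF \<delta>] \<delta> e_pos[of n] e_less[of n] by (auto simp: W_def)
  have "(\<lambda>n. emeasure lborel (W n)) \<longlonglongrightarrow> emeasure lborel (\<Inter>n. W n)"
  proof (rule Lim_emeasure_decseq)
    show "decseq W"
      unfolding decseq_def W_def using angle_cone_mono[OF add_left_mono[OF e_dec]] by blast
    have "emeasure lborel (W n) \<le> emeasure lborel (ball (0 :: real^2) M)" for n
      by (rule emeasure_mono) (auto simp: W_def)
    then show "emeasure lborel (W n) \<noteq> \<infinity>" for n
      using emeasure_lborel_ball_finite[of "0 :: real^2" M] by (metis leD)
  qed (use W_sets in auto)
  also have "(\<Inter>n. W n) = {}"
  proof safe
    fix \<xi> assume \<xi>: "\<xi> \<in> (\<Inter>n. W n)"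
    have "\<xi> \<in> angle_cone (\<delta> + e n)" and not: "\<xi> \<notin> angle_cone \<delta>" for n
      using \<xi> by (auto simp: W_def)
    then have cone: "\<xi> $ 1 > 0" "\<bar>\<xi> $ 2\<bar> \<le> \<xi> $ 1 * tan (\<delta> + e n)" for n
      using angle_cone_iff[of "\<delta> + e n" \<xi>] \<delta> e_pos[of n] e_less[of n] by auto
    have "cos \<delta> \<noteq> 0" using \<delta> cos_gt_zero_pi[of \<delta>] by auto
    then have "(\<lambda>n. \<xi> $ 1 * tan (\<delta> + e n)) \<longlonglongrightarrow> \<xi> $ 1 * tan \<delta>"
      by (intro tendsto_mult tendsto_const isCont_tendsto_compose[OF isCont_tan] e_lim)
    then have "\<bar>\<xi> $ 2\<bar> \<le> \<xi> $ 1 * tan \<delta>"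
      using cone(2) by (intro LIMSEQ_le_const) auto
    with cone(1) not show "\<xi> \<in> {}" by (simp add: angle_cone_iff[OF \<delta>])
  qed
  finally have "(\<lambda>n. emeasure lborel (W n)) \<longlonglongrightarrow> 0" by simp
  then have "eventually (\<lambda>n. emeasure lborel (W n) < ennreal \<eta>) sequentially"
    using \<eta> by (intro order_tendstoD) auto
  then obtain n where "emeasure lborel (W n) < ennreal \<eta>"
    by (auto simp: eventually_sequentially)
  then show ?thesis
    using e_pos[of n] e_less[of n] by (auto simp: W_def intro!: exI[of _ "e n"])
qed

text \<open>Polar coordinates on the cone use only \<sigma> > 0; adding the opposite half-line gives
  the full-line integral controlled by the Radon transform.\<close>

lemma sq_int_ft_cone_le:
  assumes f: "integrable lborel f" and \<delta>: "0 < \<delta>" "\<delta> < pi / 2"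
  shows "(\<integral>\<^sup>+ \<xi>. ennreal ((cmod (ft (-1) f \<xi>))\<^sup>2) * ennreal (1 / norm \<xi>) * indicator (angle_cone \<delta>) \<xi> \<partial>lborel)
     \<le> ennreal (2 * pi) * sq_int (lborel \<Otimes>\<^sub>M arclength) (radon \<delta> f)"
proof -
  have [measurable]: "f \<in> borel_measurable borel" using f by auto
  have "(\<integral>\<^sup>+ \<xi>. ennreal ((cmod (ft (-1) f \<xi>))\<^sup>2) * ennreal (1 / norm \<xi>) * indicator (angle_cone \<delta>) \<xi> \<partial>lborel) =
    (\<integral>\<^sup>+ \<theta>. (\<integral>\<^sup>+ \<sigma>. ennreal ((cmod (ft (-1) f (\<sigma> *\<^sub>R circle_point \<theta>)))\<^sup>2) * indicator {0<..} \<sigma> \<partial>lborel) * indicator {- \<delta>..\<delta>} \<theta> \<partial>lborel)"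
    by (rule nn_integral_angle_cone_polar[OF _ \<delta>, symmetric]) simp
  also have "\<dots> \<le> (\<integral>\<^sup>+ \<theta>. (\<integral>\<^sup>+ \<sigma>. ennreal ((cmod (ft (-1) f (\<sigma> *\<^sub>R circle_point \<theta>)))\<^sup>2) \<partial>lborel) * indicator {- \<delta>..\<delta>} \<theta> \<partial>lborel)"
    by (intro nn_integral_mono mult_right_mono) (auto simp: indicator_def)
  also have "\<dots> \<le> ennreal (2 * pi) * sq_int (lborel \<Otimes>\<^sub>M arclength) (radon \<delta> f)"
    by (rule sq_int_radon_ge[OF f \<delta>])
  finally show ?thesis .
qed

text \<open>The weight is 1 / sqrt (1 + |\<xi>|^2). The second bound is used with \<open>M\<close> =
  \<open>norm \<xi>\<close> on the inner cone, to meet the polar density, and with the fixed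
  threshold at high frequencies; the first serves the low ones.\<close>

lemma sobolev_weight_le:
  fixes \<xi> :: "'a::real_normed_vector"
  shows "(1 + (norm \<xi>)\<^sup>2) powr (-1/2) \<le> 1"
    and "0 < M \<Longrightarrow> M \<le> norm \<xi> \<Longrightarrow> (1 + (norm \<xi>)\<^sup>2) powr (-1/2) \<le> 1 / M"
proof -
  have eq: "(1 + (norm \<xi>)\<^sup>2) powr (-1/2) = 1 / sqrt (1 + (norm \<xi>)\<^sup>2)"
  proof -
    have pos: "0 \<le> 1 + (norm \<xi>)\<^sup>2" by simp
    show ?thesis
      using powr_minus[of "1 + (norm \<xi>)\<^sup>2" "1 / 2"] unfolding powr_half_sqrt[OF pos]
      by (simp add: inverse_eq_divide)
  qed
  have s: "1 \<le> sqrt (1 + (norm \<xi>)\<^sup>2)" by simp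
  show "(1 + (norm \<xi>)\<^sup>2) powr (-1/2) \<le> 1"
    using s unfolding eq by (intro mult_imp_div_pos_le) linarith+
  show "(1 + (norm \<xi>)\<^sup>2) powr (-1/2) \<le> 1 / M" if M: "0 < M" "M \<le> norm \<xi>"
  proof -
    have "M \<le> sqrt (1 + (norm \<xi>)\<^sup>2)"
      using M by (intro real_le_rsqrt order_trans[OF power_mono[of M "norm \<xi>" 2]]) auto
    then show ?thesis unfolding eq using M by (intro divide_left_mono) (auto simp: add_pos_nonneg)
  qed
qed

section \<open>Absorption of the high-frequency and thin-sector errors\<close>

theorem theorem3p2:
  fixes \<delta> N :: real
  assumes "0 < \<delta>" and "\<delta> < pi / 2" and "0 \<le> N"
  shows "\<exists>\<epsilon>>0. \<delta> + \<epsilon> \<le> pi / 2 \<and>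
    (\<forall>f \<in> D_set \<delta> N \<epsilon>.
       sobolev_norm (-1/2) (cone_multiplier (\<delta> + \<epsilon>) f)
         \<le> 2 * L2_norm (lborel \<Otimes>\<^sub>M arclength) (radon \<delta> f))"
proof -
  note \<delta> = assms(1,2)
  define c where "c = measure lborel (ball (0 :: real^2) 1)"
  have c: "c \<ge> 0" "emeasure lborel (ball (0 :: real^2) 1) = ennreal c"
    using emeasure_lborel_ball_finite[of "0 :: real^2" 1] by (auto simp: c_def emeasure_eq_ennreal_measure)
  \<comment> \<open>High frequencies contribute at most a factor \<open>N\<^sup>2 / M\<close> of the
    left-hand side, here at most 1 / 4; the added 1 keeps \<open>M\<close> positive when N =
    0.\<close>
  define M where "M = 4 * N\<^sup>2 + 1"
  have M_pos: "M > 0" by (auto simp: M_def add_nonneg_pos)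
  then have M: "M > 0" "N\<^sup>2 / M \<le> 1 / 4" by (auto simp: pos_divide_le_eq) (simp add: M_def)
  \<comment> \<open>The area that makes the low-frequency error at most a quarter of the left-hand
    side; the added 1 keeps the denominator positive.\<close>
  define \<eta> where "\<eta> = (2 * pi)\<^sup>2 / (4 * (N\<^sup>2 * c + 1))"
  have Nc: "N\<^sup>2 * c + 1 > 0" using c by (simp add: add_nonneg_pos)
  then have \<eta>: "\<eta> > 0" by (simp add: \<eta>_def)
  have "N\<^sup>2 * (c * \<eta> / (2 * pi)\<^sup>2) = (N\<^sup>2 * c) / (N\<^sup>2 * c + 1) / 4"
    by (simp add: \<eta>_def)
  also have "\<dots> \<le> 1 / 4" using Nc by (simp add: divide_simps)
  finally have \<eta>_le: "N\<^sup>2 * (c * \<eta> / (2 * pi)\<^sup>2) \<le> 1 / 4" .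
  obtain \<epsilon> where \<epsilon>: "\<epsilon> > 0" "\<delta> + \<epsilon> < pi / 2"
    and W: "emeasure lborel ((angle_cone (\<delta> + \<epsilon>) - angle_cone \<delta>) \<inter> ball 0 M) \<le> ennreal \<eta>"
    using angle_cone_increment_small[OF \<delta> \<eta>] by blast
  define W where "W = (angle_cone (\<delta> + \<epsilon>) - angle_cone \<delta>) \<inter> ball 0 M"
  have K [measurable]: "angle_cone (\<delta> + \<epsilon>) \<in> sets borel" "angle_cone \<delta> \<in> sets borel"
    using \<delta> \<epsilon> by (auto intro!: angle_cone_sets)
  then have [measurable]: "W \<in> sets borel" by (auto simp: W_def)
  show ?thesis
  proof (intro exI[of _ \<epsilon>] conjI ballI)
    fix f assume "f \<in> D_set \<delta> N \<epsilon>"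
    then have f: "f \<in> L2_unit_ball"
      and D: "L2_norm lborel f \<le> ennreal N * sobolev_norm (-1/2) (cone_multiplier (\<delta> + \<epsilon>) f)"
      by (auto simp: D_set_def)
    note int = L2_unit_ballD(2)[OF f]
    have [measurable]: "f \<in> borel_measurable borel" using int by auto
    define E where "E = (\<lambda>\<xi>. ennreal ((cmod (ft (-1) f \<xi>))\<^sup>2))"
    define n2 where "n2 = sq_int lborel f"
    define b where "b = sq_int (lborel \<Otimes>\<^sub>M arclength) (radon \<delta> f)"
    define I where "I = (\<integral>\<^sup>+ \<xi>. ennreal ((1 + (norm \<xi>)\<^sup>2) powr (-1/2) * (cmod (ft (-1) f \<xi>))\<^sup>2) * indicator (angle_cone (\<delta> + \<epsilon>)) \<xi> \<partial>lborel)"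
    define a where "a = ennreal (1 / (2 * pi)\<^sup>2) * I"
    have sob: "sobolev_norm (-1/2) (cone_multiplier (\<delta> + \<epsilon>) f) = ennreal_sqrt a"
      using sobolev_norm_cone_multiplier[OF f, of "\<delta> + \<epsilon>"] \<delta> \<epsilon> by (simp add: a_def I_def)
    have bessel: "integral\<^sup>N lborel E \<le> ennreal ((2 * pi)\<^sup>2) * n2"
      using sq_int_ft_le[OF int, of "-1"] by (simp add: E_def n2_def)
    have n2: "n2 < \<infinity>" using L2_unit_ballD(1)[OF f] by (simp add: L2_iff n2_def)
    have "I \<le> integral\<^sup>N lborel E"
      unfolding I_def E_def using sobolev_weight_le(1)
      by (intro nn_integral_mono) (auto simp: indicator_def intro!: mult_left_le_one_le)
    also note bessel
    also have "ennreal ((2 * pi)\<^sup>2) * n2 < \<infinity>" using n2 by (simp add: ennreal_mult_less_top)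
    finally have "I < \<infinity>" .
    \<comment> \<open>Finiteness is what permits moving a multiple of \<open>a\<close> to the
      left-hand side later.\<close>
    then have a_fin: "a \<noteq> \<infinity>" by (auto simp: a_def ennreal_mult_eq_top_iff)
    have n2_le: "n2 \<le> ennreal (N\<^sup>2) * a"
      using D a_fin assms(3) unfolding sob by (intro le_of_ennreal_sqrt_le) (auto simp: n2_def L2_norm_def)
    have "I \<le> (\<integral>\<^sup>+ \<xi>. (E \<xi> * ennreal (1 / norm \<xi>) * indicator (angle_cone \<delta>) \<xi> + ennreal (1 / M) * E \<xi>) +
        ennreal c * n2 * indicator W \<xi> \<partial>lborel)"
      unfolding I_def
    proof (rule nn_integral_mono)
      fix \<xi> :: "real^2"
      let ?w = "(1 + (norm \<xi>)\<^sup>2) powr (-1/2)"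
      have w: "ennreal (?w * (cmod (ft (-1) f \<xi>))\<^sup>2) = ennreal ?w * E \<xi>"
        by (simp add: E_def ennreal_mult)
      have mono: "ennreal ?w * E \<xi> \<le> ennreal t * E \<xi>" if "?w \<le> t" for t
        using that by (intro mult_right_mono ennreal_leI) auto
      \<comment> \<open>Outside the trivial first case each remaining case is charged to one
        summand: the inner cone to the Radon term, high frequencies to Bessel, and the thin
        low-frequency sector \<open>W\<close> to the pointwise bound.\<close>
      consider "\<xi> \<notin> angle_cone (\<delta> + \<epsilon>)" | "\<xi> \<in> angle_cone \<delta>" | "norm \<xi> \<ge> M"
        | "\<xi> \<in> angle_cone (\<delta> + \<epsilon>)" "\<xi> \<in> W" by (cases "M \<le> norm \<xi>") (auto simp: W_def)
      then show "ennreal (?w * (cmod (ft (-1) f \<xi>))\<^sup>2) * indicator (angle_cone (\<delta> + \<epsilon>)) \<xi> \<le>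
        (E \<xi> * ennreal (1 / norm \<xi>) * indicator (angle_cone \<delta>) \<xi> + ennreal (1 / M) * E \<xi>) + ennreal c * n2 * indicator W \<xi>"
      proof cases
        case 2
        then have "\<xi> \<noteq> 0" by (auto simp: angle_cone_def)
        then have "ennreal ?w * E \<xi> \<le> E \<xi> * ennreal (1 / norm \<xi>) * indicator (angle_cone \<delta>) \<xi>"
          using mono[OF sobolev_weight_le(2)[of "norm \<xi>" \<xi>]] 2 by (simp add: mult.commute)
        moreover have "ennreal ?w * E \<xi> * indicator (angle_cone (\<delta> + \<epsilon>)) \<xi> \<le> ennreal ?w * E \<xi>"
          by (auto simp: indicator_def)
        ultimately show ?thesis unfolding w by (intro add_increasing2) auto
      next
        case 3
        have "ennreal ?w * E \<xi> * indicator (angle_cone (\<delta> + \<epsilon>)) \<xi> \<le> ennreal ?w * E \<xi>"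
          by (auto simp: indicator_def)
        also have "\<dots> \<le> ennreal (1 / M) * E \<xi>" by (rule mono[OF sobolev_weight_le(2)[OF M(1) 3]])
        finally show ?thesis unfolding w by (intro add_increasing2 add_increasing) auto
      next
        case 4
        have "ennreal ?w * E \<xi> \<le> E \<xi>" using mono[OF sobolev_weight_le(1)] by simp
        also have "\<dots> \<le> ennreal c * n2" using cmod_ft_sq_le[OF f, of "-1" \<xi>] by (simp add: E_def c n2_def)
        finally show ?thesis using 4 unfolding w by (intro add_increasing) auto
      qed simp
    qed
    also have "\<dots> = ((\<integral>\<^sup>+ \<xi>. E \<xi> * ennreal (1 / norm \<xi>) * indicator (angle_cone \<delta>) \<xi> \<partial>lborel) + ennreal (1 / M) * integral\<^sup>N lborel E) +
        ennreal c * n2 * emeasure lborel W"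
      by (simp add: E_def nn_integral_add nn_integral_cmult nn_integral_cmult_indicator)
    also have "\<dots> \<le> (ennreal (2 * pi) * b + ennreal (1 / M) * (ennreal ((2 * pi)\<^sup>2) * n2)) + ennreal c * n2 * ennreal \<eta>"
      using sq_int_ft_cone_le[OF int \<delta>] bessel W
      by (intro add_mono mult_left_mono) (auto simp: E_def b_def W_def)
    finally have I_le: "I \<le> (ennreal (2 * pi) * b + ennreal (1 / M) * (ennreal ((2 * pi)\<^sup>2) * n2)) + ennreal c * n2 * ennreal \<eta>" .
    have "a \<le> 4 * b"
    proof (cases b)
      case (real b')
      obtain n' where n': "n2 = ennreal n'" "0 \<le> n'" using n2 by (cases n2) auto
      obtain a' where a': "a = ennreal a'" "0 \<le> a'" using a_fin by (cases a) auto
      obtain i where i: "I = ennreal i" "0 \<le> i" using \<open>I < \<infinity>\<close> by (cases I) auto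
      have pi2: "(2 * pi)\<^sup>2 > 0" by simp
      have ai: "a' = i / (2 * pi)\<^sup>2"
      proof -
        have "ennreal a' = ennreal (1 / (2 * pi)\<^sup>2 * i)"
          using a_def unfolding a'(1) i(1) by (subst ennreal_mult) (use i(2) in auto)
        then show ?thesis using a' i by (simp add: ennreal_inj)
      qed
      have "ennreal i \<le> ennreal ((2 * pi * b' + 1 / M * ((2 * pi)\<^sup>2 * n')) + c * n' * \<eta>)"
      proof -
        have "(ennreal p * ennreal x + ennreal m * (ennreal q * ennreal y)) + ennreal z * ennreal y * ennreal h =
            ennreal ((p * x + m * (q * y)) + z * y * h)"
          if "0 \<le> p" "0 \<le> x" "0 \<le> m" "0 \<le> q" "0 \<le> y" "0 \<le> z" "0 \<le> h" for p x m q y z h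
          using that by (simp add: ennreal_mult ennreal_plus)
        note * = this[of "2 * pi" b' "1 / M" "(2 * pi)\<^sup>2" n' c \<eta>]
        show ?thesis
          using I_le unfolding real(2) i(1) n'(1) by (subst (asm) *) (use real n' c M \<eta> in auto)
      qed
      then have "i \<le> (2 * pi * b' + 1 / M * ((2 * pi)\<^sup>2 * n')) + c * n' * \<eta>"
        using real n' c M \<eta> by (subst (asm) ennreal_le_iff) auto
      then have "a' \<le> ((2 * pi * b' + 1 / M * ((2 * pi)\<^sup>2 * n')) + c * n' * \<eta>) / (2 * pi)\<^sup>2"
        unfolding ai by (rule divide_right_mono) simp
      also have "\<dots> = b' / (2 * pi) + n' * (1 / M + c * \<eta> / (2 * pi)\<^sup>2)"
        using M by (simp add: field_simps power2_eq_square)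
      also have "n' * (1 / M + c * \<eta> / (2 * pi)\<^sup>2) \<le> (N\<^sup>2 * a') * (1 / M + c * \<eta> / (2 * pi)\<^sup>2)"
      proof (rule mult_right_mono)
        have "ennreal n' \<le> ennreal (N\<^sup>2 * a')" using n2_le n' a' by (simp add: ennreal_mult)
        then show "n' \<le> N\<^sup>2 * a'" using a' by (subst (asm) ennreal_le_iff) auto
        show "0 \<le> 1 / M + c * \<eta> / (2 * pi)\<^sup>2" using M c \<eta> by simp
      qed
      also have "\<dots> = a' * (N\<^sup>2 / M + N\<^sup>2 * (c * \<eta> / (2 * pi)\<^sup>2))"
        by (simp add: algebra_simps)
      also have "\<dots> \<le> a' * (1 / 4 + 1 / 4)"
        using a' M \<eta>_le by (intro mult_left_mono add_mono) auto
      \<comment> \<open>Half of \<open>a'\<close> is absorbed into the left-hand side, which doubles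
        b' / (2 * pi).\<close>
      finally have "a' \<le> b' / pi" by (simp add: field_simps)
      also have "\<dots> \<le> 4 * b'"
      proof -
        have "1 \<le> 4 * pi" using pi_gt3 by simp
        from mult_left_mono[OF this, of b'] show ?thesis using real by (simp add: divide_simps mult_ac)
      qed
      finally have "ennreal a' \<le> ennreal (4 * b')" by (rule ennreal_leI)
      then show ?thesis using a' real by (simp add: ennreal_mult)
    qed (simp add: ennreal_mult_top)
    then show "sobolev_norm (-1/2) (cone_multiplier (\<delta> + \<epsilon>) f) \<le> 2 * L2_norm (lborel \<Otimes>\<^sub>M arclength) (radon \<delta> f)"
      unfolding sob L2_norm_def b_def[symmetric] by (rule ennreal_sqrt_le_twice)
  qed (use \<epsilon> in auto)
qed

end
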